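(* Let $n$ be a positive integer with $n\in 4\mathbb{Z}$, let $\Omega=\{1,\ldots,n\}$, and let $\mathcal{C}\subseteq\mathcal{E}(\Omega)$ be a binary linear code such that $\Omega\in\mathcal{C}$ and such that for any distinct $i,j\in\Omega$ there is some $T_{ij}\in\mathcal{C}$ with $i\in T_{ij}$ and $j\notin T_{ij}$. Let $H^{(1)},H^{(2)},H^{(3)}\in\{0,\frac12,\frac1{16}\}^n$, and suppose that for $i=1,2,3$ the $L(\frac12,0)^{\otimes n}_{\mathcal{C}}$-submodule $W_{H^{(i)},\mathcal{C}}$ of the irreducible $L(\frac12,0)^{\otimes n}$-module $W_{H^{(i)}}$ generated by the lowest conformal weight vector $v_{H^{(i)}}$ is an integral form of $W_{H^{(i)}}$. Identify $W_{H^{(3)}}$ with its contragredient $W_{H^{(3)}}'$ using the form $(\cdot,\cdot)_{H^{(3)}}$, so that the graded $\mathbb{Z}$-dual of $W_{H^{(3)},\mathcal{C}}$ is $$W_{H^{(3)},\mathcal{C}}'=\{w\in W_{H^{(3)}} : (w,u)_{H^{(3)}}\in\mathbb{Z}\text{ for all }u\in W_{H^{(3)},\mathcal{C}}\}.$$ Then an intertwining operator $\mathcal{Y}$ of type $\binom{W_{H^{(3)}}}{W_{H^{(1)}}\,W_{H^{(2)}}}$ is integral with respect to $W_{H^{(1)},\mathcal{C}}$, $W_{H^{(2)},\mathcal{C}}$ and $W_{H^{(3)},\mathcal{C}}'$ if and only if the coefficient of $\mathcal{Y}(v_{H^{(1)}},x)v_{H^{(2)}}$ lying in the lowest conformal weight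 space of $W_{H^{(3)}}$ is in $\mathbb{Z}v_{H^{(3)}}$.
   Context: Vertex operator algebras, modules, and intertwining operators are over $\mathbb{C}$, with the usual definitions (Frenkel–Huang–Lepowsky). Write $Y(u,x)=\sum_{m\in\mathbb{Z}}u_m x^{-m-1}$. A vertex subring of $V$ is an additive subgroup containing $\mathbf 1$ and closed under all products $(u,v)\mapsto u_mv$, $m\in\mathbb{Z}$. An integral form of a vertex operator algebra $V$ is a vertex subring $V_\mathbb{Z}$ which is the $\mathbb{Z}$-span of a $\mathbb{C}$-basis of $V$ and is compatible with the conformal weight grading ($V_\mathbb{Z}=\coprod_m V_{(m)}\cap V_\mathbb{Z}$). An integral form of a $V$-module $W$ (with respect to $V_\mathbb{Z}$) is an additive subgroup $W_\mathbb{Z}\subseteq W$ closed under all $u_m$, $u\in V_\mathbb{Z}$, $m\in\mathbb{Z}$, which is the $\mathbb{Z}$-span of a $\mathbb{C}$-basis of $W$ and satisfies $W_\mathbb{Z}=\coprod_{h\in\mathbb{C}}W_{(h)}\cap W_\mathbb{Z}$. $W\{x\}$ denotes formal series in arbitrary complex powers of $x$ with coefficients in $W$. An intertwining operator $\mathcal{Y}$ of type $\binom{W^{(3)}}{W^{(1)}\,W^{(2)}}$ is integral with respect to integral forms $W^{(i)}_\mathbb{Z}$ of $W^{(i)}$ ($i=1,2,3$) if $\mathcal{Y}(w_{(1)},x)w_{(2)}\in W^{(3)}_\mathbb{Z}\{x\}$ for all $w_{(1)}\in W^{(1)}_\mathbb{Z}$, $w_{(2)}\in W^{(2)}_\mathbb{Z}$.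 $L(\ell,h)$ is the irreducible lowest weight module for the Virasoro algebra of central charge $\ell$ and lowest conformal weight $h$. $L(\frac12,0)$ is the simple Virasoro vertex operator algebra of central charge $\frac12$ with irreducible modules $L(\frac12,h)$, $h\in\{0,\frac12,\frac1{16}\}$. Fix $v_h$ spanning the lowest weight space of $L(\frac12,h)$, with $v_0=\mathbf 1$. For $H=(h_1,\ldots,h_n)\in\{0,\frac12,\frac1{16}\}^n$, $W_H=L(\frac12,h_1)\otimes\cdots\otimes L(\frac12,h_n)$ is the tensor product module for the tensor product vertex operator algebra $L(\frac12,0)^{\otimes n}$, and $v_H=v_{h_1}\otimes\cdots\otimes v_{h_n}$. Invariant bilinear forms: a bilinear form on a module $W$ is invariant if $(Y(v,x)w',w)=(w',Y(e^{xL(1)}(-x^{-2})^{L(0)}v,x^{-1})w)$. Let $(\cdot,\cdot)_h$ be the (nondegenerate) invariant bilinear form on $L(\frac12,h)$ with $(v_h,v_h)_h=1$; then $(\cdot,\cdot)_H$ is the nondegenerate invariant form on $W_H$ given by $(a_1\otimes\cdots\otimes a_n,b_1\otimes\cdots\otimes b_n)_H=\prod_i(a_i,b_i)_{h_i}$. Codes: for a finite set $\Omega$, $P(\Omega)$ is an $\mathbb{F}_2$-vector space under symmetric difference; a binary linear code is an $\mathbb{F}_2$-subspace of $P(\Omega)$; $\mathcal{E}(\Omega)$ is the code of even-cardinality subsets. For $1\le i\le n$, $\omega^{(i)}\in L(\frac12,0)^{\otimes n}$ has the conformal vector of $L(\frac12,0)$ in the $i$-th tensor factor and $\mathbf 1$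 elsewhere. For $T\subseteq\Omega=\{1,\ldots,n\}$, $\omega_T=\sum_{i\notin T}\omega^{(i)}-\sum_{i\in T}\omega^{(i)}$. $L(\frac12,0)^{\otimes n}_{\mathcal{C}}$ denotes the vertex subring of $L(\frac12,0)^{\otimes n}$ generated by all $\omega_T$, $T\in\mathcal{C}$; under the stated conditions on $n$ and $\mathcal{C}$ it is an integral form of $L(\frac12,0)^{\otimes n}$. *)

theory Defs
  imports Complex_Main "HOL-Library.FuncSet" "HOL-Library.Groups_Big_Fun"
begin

section \<open>Complex vector spaces\<close>

class complex_vector = ab_group_add +
  fixes scaleC :: "complex \<Rightarrow> 'a \<Rightarrow> 'a" (infixr "*\<^sub>C" 75)
  assumes scaleC_add_right: "a *\<^sub>C (x + y) = a *\<^sub>C x + a *\<^sub>C y"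
    and scaleC_add_left: "(a + b) *\<^sub>C x = a *\<^sub>C x + b *\<^sub>C x"
    and scaleC_scaleC: "a *\<^sub>C (b *\<^sub>C x) = (a * b) *\<^sub>C x"
    and scaleC_one: "1 *\<^sub>C x = x"

global_interpretation cvs: vector_space "scaleC :: complex \<Rightarrow> 'a \<Rightarrow> 'a::complex_vector"
  by unfold_locales (rule scaleC_add_right scaleC_add_left scaleC_scaleC scaleC_one)+

instantiation complex :: complex_vector
begin

definition scaleC_complex :: "complex \<Rightarrow> complex \<Rightarrow> complex"
  where "scaleC_complex a x = a * x"

instance
  by standard (simp_all add: scaleC_complex_def algebra_simps)

end

text \<open>All spaces below are subspaces of an ambient type; maps are only constrained on these
  carriers.\<close>

definition linear_on :: "'a::complex_vector set \<Rightarrow> ('a \<Rightarrow> 'b::complex_vector) \<Rightarrow> bool"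
  where "linear_on S f \<longleftrightarrow>
    (\<forall>x\<in>S. \<forall>y\<in>S. f (x + y) = f x + f y) \<and> (\<forall>a. \<forall>x\<in>S. f (a *\<^sub>C x) = a *\<^sub>C f x)"

definition bilinear_on ::
    "'a::complex_vector set \<Rightarrow> 'b::complex_vector set \<Rightarrow> ('a \<Rightarrow> 'b \<Rightarrow> 'c::complex_vector) \<Rightarrow> bool"
  where "bilinear_on S T f \<longleftrightarrow>
    (\<forall>x\<in>S. linear_on T (f x)) \<and> (\<forall>y\<in>T. linear_on S (\<lambda>x. f x y))"

definition multilinear_on ::
    "'i set \<Rightarrow> ('i \<Rightarrow> 'a::complex_vector set) \<Rightarrow> (('i \<Rightarrow> 'a) \<Rightarrow> 'b::complex_vector) \<Rightarrow> bool"
  where "multilinear_on I X f \<longleftrightarrow>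
    (\<forall>w\<in>Pi\<^sub>E I X. \<forall>i\<in>I. linear_on (X i) (\<lambda>a. f (w(i := a))))"

definition add_subgroup :: "'a::ab_group_add set \<Rightarrow> bool"
  where "add_subgroup A \<longleftrightarrow> 0 \<in> A \<and> (\<forall>x\<in>A. \<forall>y\<in>A. x - y \<in> A)"

abbreviation int_span :: "'a::ab_group_add set \<Rightarrow> 'a set"
  where "int_span B \<equiv> add_subgroup hull B"


section \<open>Vertex operator algebras, modules and intertwining operators\<close>

text \<open>\<open>action W v m w\<close> is \<open>v\<^sub>m w\<close>, where \<open>Y\<^sub>W(v,x) = \<Sum>\<^sub>m v\<^sub>m x\<^sup>-\<^sup>m\<^sup>-\<^sup>1\<close>. The record of a vertex operator
  algebra extends that of its adjoint module.\<close>

record ('v, 'w) vmodule =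
  mspace :: "'w set"
  action :: "'v \<Rightarrow> int \<Rightarrow> 'w \<Rightarrow> 'w"

record 'v voa = "('v, 'v) vmodule" +
  vacuum :: 'v
  conformal :: 'v

definition virL :: "'v voa \<Rightarrow> ('v, 'w, 'z) vmodule_scheme \<Rightarrow> int \<Rightarrow> 'w \<Rightarrow> 'w"
  where "virL V W m = action W (conformal V) (m + 1)"

definition wt_space ::
    "'v voa \<Rightarrow> ('v, 'w::complex_vector, 'z) vmodule_scheme \<Rightarrow> complex \<Rightarrow> 'w set"
  where "wt_space V W h = {w \<in> mspace W. virL V W 0 w = h *\<^sub>C w}"

text \<open>The Jacobi identity for \<open>v \<in> V\<close>, \<open>w1 \<in> W1\<close>, \<open>w2 \<in> W2\<close>, stated as the equality of the coefficients
  of \<open>x\<^sub>0\<^sup>-\<^sup>l\<^sup>-\<^sup>1 x\<^sub>1\<^sup>-\<^sup>m\<^sup>-\<^sup>1 x\<^sub>2\<^sup>-\<^sup>b\<^sup>-\<^sup>1\<close>. Here \<open>Y w1 b w2\<close> is the coefficient of \<open>x\<^sup>-\<^sup>b\<^sup>-\<^sup>1\<close>; the exponents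
  \<open>b\<close> are integers for module vertex operators and complex numbers for intertwining operators.
  The sums have finite support by lower truncation.\<close>

definition jacobi ::
    "'v voa \<Rightarrow> ('v, 'w1, 'z1) vmodule_scheme \<Rightarrow> ('v, 'w2, 'z2) vmodule_scheme
      \<Rightarrow> ('v, 'w3::complex_vector, 'z3) vmodule_scheme
      \<Rightarrow> ('w1 \<Rightarrow> 'i::comm_ring_1 \<Rightarrow> 'w2 \<Rightarrow> 'w3) \<Rightarrow> bool"
  where "jacobi V W1 W2 W3 Y \<longleftrightarrow>
    (\<forall>v\<in>mspace V. \<forall>w1\<in>mspace W1. \<forall>w2\<in>mspace W2. \<forall>l m :: int. \<forall>b :: 'i.
      Sum_any (\<lambda>i::nat. ((-1) ^ i * ((of_int l :: complex) gchoose i)) *\<^sub>C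
        (action W3 v (m + l - int i) (Y w1 (b + of_nat i) w2)
          - ((-1) powi l) *\<^sub>C Y w1 (b + of_int l - of_nat i) (action W2 v (m + int i) w2)))
      = Sum_any (\<lambda>i::nat. ((of_int m :: complex) gchoose i) *\<^sub>C
          Y (action W1 v (l + int i) w1) (of_int m + b - of_nat i) w2))"

definition vertex_map ::
    "'v voa \<Rightarrow> ('v, 'w1::complex_vector, 'z1) vmodule_scheme
      \<Rightarrow> ('v, 'w2::complex_vector, 'z2) vmodule_scheme
      \<Rightarrow> ('v, 'w3::complex_vector, 'z3) vmodule_scheme
      \<Rightarrow> ('w1 \<Rightarrow> 'i::comm_ring_1 \<Rightarrow> 'w2 \<Rightarrow> 'w3) \<Rightarrow> bool"
  where "vertex_map V W1 W2 W3 Y \<longleftrightarrow>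
    (\<forall>w1\<in>mspace W1. \<forall>w2\<in>mspace W2. \<forall>b. Y w1 b w2 \<in> mspace W3) \<and>
    (\<forall>b. bilinear_on (mspace W1) (mspace W2) (\<lambda>w1. Y w1 b)) \<and>
    (\<forall>w1\<in>mspace W1. \<forall>w2\<in>mspace W2. \<forall>b. \<exists>N. \<forall>k\<ge>N. Y w1 (b + of_nat k) w2 = 0) \<and>
    jacobi V W1 W2 W3 Y"

definition virasoro_relations ::
    "complex \<Rightarrow> 'w::complex_vector set \<Rightarrow> (int \<Rightarrow> 'w \<Rightarrow> 'w) \<Rightarrow> bool"
  where "virasoro_relations c W L \<longleftrightarrow>
    (\<forall>m n. \<forall>w\<in>W. L m (L n w) - L n (L m w) =
      of_int (m - n) *\<^sub>C L (m + n) w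
      + (if m + n = 0 then (of_int (m ^ 3 - m) / 12 * c) *\<^sub>C w else 0))"

text \<open>The conformal weight spaces are the \<open>L(0)\<close>-eigenspaces, so their sum is automatically direct.
  The last conjunct of the grading says that \<open>W\<^bsub>(h+k)\<^esub> = 0\<close> for \<open>k \<in> \<int>\<close> sufficiently negative.\<close>

definition voa_module ::
    "complex \<Rightarrow> 'v::complex_vector voa \<Rightarrow> ('v, 'w::complex_vector, 'z) vmodule_scheme \<Rightarrow> bool"
  where "voa_module c V W \<longleftrightarrow>
    cvs.subspace (mspace W) \<and>
    mspace W = cvs.span (\<Union>h. wt_space V W h) \<and>
    (\<forall>h. \<exists>B. finite B \<and> wt_space V W h \<subseteq> cvs.span B) \<and>
    (\<forall>h. \<exists>N::int. \<forall>k<N. wt_space V W (h + of_int k) = {0}) \<and>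
    vertex_map V V W W (action W) \<and>
    (\<forall>w\<in>mspace W. \<forall>m. action W (vacuum V) m w = (if m = -1 then w else 0)) \<and>
    virasoro_relations c (mspace W) (virL V W) \<and>
    (\<forall>v\<in>mspace V. \<forall>w\<in>mspace W. \<forall>m.
      action W (virL V V (-1) v) m w = (- of_int m) *\<^sub>C action W v (m - 1) w)"

definition is_voa :: "complex \<Rightarrow> 'v::complex_vector voa \<Rightarrow> bool"
  where "is_voa c V \<longleftrightarrow>
    voa_module c V V \<and>
    (\<forall>h. wt_space V V h \<noteq> {0} \<longrightarrow> h \<in> \<int>) \<and>
    vacuum V \<in> wt_space V V 0 \<and> conformal V \<in> wt_space V V 2 \<and>
    (\<forall>v\<in>mspace V. action V v (-1) (vacuum V) = v \<and> (\<forall>m\<ge>0. action V v m (vacuum V) = 0))"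

text \<open>\<open>Y w1 b w2\<close> is the coefficient of \<open>x\<^sup>-\<^sup>b\<^sup>-\<^sup>1\<close> in \<open>\<Y>(w1,x)w2\<close>; the last conjunct is the
  \<open>L(-1)\<close>-derivative property.\<close>

definition intertwining_operator ::
    "'v::complex_vector voa \<Rightarrow> ('v, 'w1::complex_vector) vmodule
      \<Rightarrow> ('v, 'w2::complex_vector) vmodule \<Rightarrow> ('v, 'w3::complex_vector) vmodule
      \<Rightarrow> ('w1 \<Rightarrow> complex \<Rightarrow> 'w2 \<Rightarrow> 'w3) \<Rightarrow> bool"
  where "intertwining_operator V W1 W2 W3 Y \<longleftrightarrow>
    vertex_map V W1 W2 W3 Y \<and>
    (\<forall>w1\<in>mspace W1. \<forall>w2\<in>mspace W2. \<forall>b.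
      Y (virL V W1 (-1) w1) b w2 = (- b) *\<^sub>C Y w1 (b - 1) w2)"


section \<open>Invariant bilinear forms\<close>

text \<open>Invariance \<open>(Y(v,x)w',w) = (w',Y(e\<^sup>x\<^sup>L\<^sup>(\<^sup>1\<^sup>)(-x\<^sup>-\<^sup>2)\<^sup>L\<^sup>(\<^sup>0\<^sup>)v,x\<^sup>-\<^sup>1)w)\<close>, expressed as the equality of the
  coefficients of \<open>x\<^sup>-\<^sup>m\<^sup>-\<^sup>1\<close> for \<open>v\<close> homogeneous of weight \<open>k\<close>.\<close>

definition invariant_form ::
    "'v::complex_vector voa \<Rightarrow> ('v, 'w::complex_vector) vmodule \<Rightarrow> ('w \<Rightarrow> 'w \<Rightarrow> complex) \<Rightarrow> bool"
  where "invariant_form V W F \<longleftrightarrow>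
    bilinear_on (mspace W) (mspace W) F \<and>
    (\<forall>k::int. \<forall>v\<in>wt_space V V (of_int k). \<forall>w'\<in>mspace W. \<forall>w\<in>mspace W. \<forall>m.
      F (action W v m w') w =
      (-1) powi k * Sum_any (\<lambda>j::nat.
        F w' (action W ((virL V V 1 ^^ j) v) (2 * k - m - 2 - int j) w) / fact j))"

definition nondegenerate_on :: "'w::zero set \<Rightarrow> ('w \<Rightarrow> 'w \<Rightarrow> complex) \<Rightarrow> bool"
  where "nondegenerate_on W F \<longleftrightarrow>
    (\<forall>w\<in>W. (\<forall>u\<in>W. F w u = 0) \<longrightarrow> w = 0) \<and> (\<forall>w\<in>W. (\<forall>u\<in>W. F u w = 0) \<longrightarrow> w = 0)"


section \<open>Integral forms\<close>

definition vertex_subring :: "'v::complex_vector voa \<Rightarrow> 'v set \<Rightarrow> bool"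
  where "vertex_subring V A \<longleftrightarrow>
    A \<subseteq> mspace V \<and> add_subgroup A \<and> vacuum V \<in> A \<and>
    (\<forall>u\<in>A. \<forall>v\<in>A. \<forall>m. action V u m v \<in> A)"

definition subring_module :: "'v set \<Rightarrow> ('v, 'w::complex_vector) vmodule \<Rightarrow> 'w set \<Rightarrow> bool"
  where "subring_module A W M \<longleftrightarrow>
    M \<subseteq> mspace W \<and> add_subgroup M \<and> (\<forall>u\<in>A. \<forall>w\<in>M. \<forall>m. action W u m w \<in> M)"

definition module_integral_form ::
    "'v::complex_vector voa \<Rightarrow> 'v set \<Rightarrow> ('v, 'w::complex_vector) vmodule \<Rightarrow> 'w set \<Rightarrow> bool"
  where "module_integral_form V A W M \<longleftrightarrow>
    subring_module A W M \<and>
    (\<exists>B. cvs.independent B \<and> cvs.span B = mspace W \<and> M = int_span B) \<and>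
    M = int_span (\<Union>h. wt_space V W h \<inter> M)"

definition integral_intertwining ::
    "'w1 set \<Rightarrow> 'w2 set \<Rightarrow> 'w3 set \<Rightarrow> ('w1 \<Rightarrow> complex \<Rightarrow> 'w2 \<Rightarrow> 'w3) \<Rightarrow> bool"
  where "integral_intertwining M1 M2 M3 Y \<longleftrightarrow> (\<forall>w1\<in>M1. \<forall>w2\<in>M2. \<forall>b. Y w1 b w2 \<in> M3)"

definition graded_int_dual ::
    "('v, 'w) vmodule \<Rightarrow> ('w \<Rightarrow> 'w \<Rightarrow> complex) \<Rightarrow> 'w set \<Rightarrow> 'w set"
  where "graded_int_dual W F M = {w \<in> mspace W. \<forall>u\<in>M. F w u \<in> \<int>}"


section \<open>The Virasoro modules \<open>L(1/2,h)\<close>\<close>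

text \<open>\<open>W\<close> is \<open>L(c,h)\<close> with lowest weight vector \<open>v\<close>. That \<open>v\<close> generates \<open>W\<close> follows from irreducibility.\<close>

definition irreducible_lowest_weight ::
    "complex \<Rightarrow> complex \<Rightarrow> 'w::complex_vector set \<Rightarrow> (int \<Rightarrow> 'w \<Rightarrow> 'w) \<Rightarrow> 'w \<Rightarrow> bool"
  where "irreducible_lowest_weight c h W L v \<longleftrightarrow>
    cvs.subspace W \<and> (\<forall>m. linear_on W (L m) \<and> L m ` W \<subseteq> W) \<and> virasoro_relations c W L \<and>
    v \<in> W \<and> v \<noteq> 0 \<and> L 0 v = h *\<^sub>C v \<and> (\<forall>m>0. L m v = 0) \<and>
    (\<forall>U. cvs.subspace U \<and> U \<subseteq> W \<and> (\<forall>m. L m ` U \<subseteq> U) \<longrightarrow> U = {0} \<or> U = W)"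

definition ising_weights :: "complex set"
  where "ising_weights = {0, 1/2, 1/16}"

text \<open>\<open>V = L(1/2,0)\<close> as a vertex operator algebra, \<open>L h = L(1/2,h)\<close> as a \<open>V\<close>-module (for \<open>h = 0\<close> the
  adjoint module), \<open>v h = v\<^sub>h\<close> and \<open>f h\<close> the normalized invariant form. This determines the data up
  to isomorphism and the choice of the \<open>v\<^sub>h\<close>.\<close>

definition ising_modules ::
    "'a::complex_vector voa \<Rightarrow> (complex \<Rightarrow> ('a, 'a) vmodule) \<Rightarrow> (complex \<Rightarrow> 'a)
      \<Rightarrow> (complex \<Rightarrow> 'a \<Rightarrow> 'a \<Rightarrow> complex) \<Rightarrow> bool"
  where "ising_modules V L v f \<longleftrightarrow>
    is_voa (1/2) V \<and> L 0 = vmodule.truncate V \<and> v 0 = vacuum V \<and>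
    (\<forall>h\<in>ising_weights.
      voa_module (1/2) V (L h) \<and>
      irreducible_lowest_weight (1/2) h (mspace (L h)) (virL V (L h)) (v h) \<and>
      invariant_form V (L h) (f h) \<and> nondegenerate_on (mspace (L h)) (f h) \<and>
      f h (v h) (v h) = 1)"


section \<open>Tensor products\<close>

text \<open>The universal property of the tensor product. The factorization of a multilinear map through \<open>T\<close>
  is unique because \<open>T\<close> is spanned by pure tensors; for existence it suffices, over a field, to
  consider scalar-valued maps; this avoids quantifying over types.\<close>

definition tensor_space ::
    "'i set \<Rightarrow> ('i \<Rightarrow> 'a::complex_vector set) \<Rightarrow> 'b::complex_vector set
      \<Rightarrow> (('i \<Rightarrow> 'a) \<Rightarrow> 'b) \<Rightarrow> bool"
  where "tensor_space I X T \<tau> \<longleftrightarrow>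
    multilinear_on I X \<tau> \<and> T = cvs.span (\<tau> ` Pi\<^sub>E I X) \<and>
    (\<forall>f :: ('i \<Rightarrow> 'a) \<Rightarrow> complex. multilinear_on I X f \<longrightarrow>
      (\<exists>g. linear_on T g \<and> (\<forall>w\<in>Pi\<^sub>E I X. g (\<tau> w) = f w)))"

text \<open>\<open>Y(\<Otimes>u\<^sub>i,x)(\<Otimes>w\<^sub>i) = \<Otimes>Y(u\<^sub>i,x)w\<^sub>i\<close>, coefficient of \<open>x\<^sup>-\<^sup>m\<^sup>-\<^sup>1\<close>. The condition that no factor vanishes
  makes the index set finite.\<close>

definition tensor_action ::
    "'i set \<Rightarrow> 'a::complex_vector voa \<Rightarrow> ('i \<Rightarrow> ('a, 'w::complex_vector, 'z) vmodule_scheme)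
      \<Rightarrow> (('i \<Rightarrow> 'a) \<Rightarrow> 'b) \<Rightarrow> (('i \<Rightarrow> 'w) \<Rightarrow> 'c)
      \<Rightarrow> ('b, 'c::complex_vector, 'z2) vmodule_scheme \<Rightarrow> bool"
  where "tensor_action I V M \<tau>0 \<tau> W \<longleftrightarrow>
    (\<forall>u\<in>Pi\<^sub>E I (\<lambda>_. mspace V). \<forall>w\<in>Pi\<^sub>E I (\<lambda>i. mspace (M i)). \<forall>m::int.
      action W (\<tau>0 u) m (\<tau> w) =
      (\<Sum>k\<in>{k \<in> I \<rightarrow>\<^sub>E (UNIV :: int set). (\<Sum>i\<in>I. - k i - 1) = - m - 1 \<and>
                  (\<forall>i\<in>I. action (M i) (u i) (k i) (w i) \<noteq> 0)}.
        \<tau> (\<lambda>i\<in>I. action (M i) (u i) (k i) (w i))))"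

definition conformal_at ::
    "'i set \<Rightarrow> 'a voa \<Rightarrow> (('i \<Rightarrow> 'a) \<Rightarrow> 'b) \<Rightarrow> 'i \<Rightarrow> 'b"
  where "conformal_at I V \<tau> i = \<tau> (\<lambda>j\<in>I. if j = i then conformal V else vacuum V)"

definition tensor_voa ::
    "complex \<Rightarrow> 'i set \<Rightarrow> 'a::complex_vector voa \<Rightarrow> 'b::complex_vector voa
      \<Rightarrow> (('i \<Rightarrow> 'a) \<Rightarrow> 'b) \<Rightarrow> bool"
  where "tensor_voa c I V VV \<tau> \<longleftrightarrow>
    is_voa (of_nat (card I) * c) VV \<and>
    tensor_space I (\<lambda>_. mspace V) (mspace VV) \<tau> \<and>
    tensor_action I V (\<lambda>_. V) \<tau> \<tau> VV \<and>
    vacuum VV = \<tau> (\<lambda>i\<in>I. vacuum V) \<and>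
    conformal VV = (\<Sum>i\<in>I. conformal_at I V \<tau> i)"

definition tensor_module ::
    "complex \<Rightarrow> 'i set \<Rightarrow> 'a::complex_vector voa \<Rightarrow> 'b::complex_vector voa
      \<Rightarrow> (('i \<Rightarrow> 'a) \<Rightarrow> 'b) \<Rightarrow> ('i \<Rightarrow> ('a, 'w::complex_vector) vmodule)
      \<Rightarrow> ('b, 'c::complex_vector) vmodule \<Rightarrow> (('i \<Rightarrow> 'w) \<Rightarrow> 'c) \<Rightarrow> bool"
  where "tensor_module c I V VV \<tau>0 M W \<tau> \<longleftrightarrow>
    voa_module (of_nat (card I) * c) VV W \<and>
    tensor_space I (\<lambda>i. mspace (M i)) (mspace W) \<tau> \<and>
    tensor_action I V M \<tau>0 \<tau> W"

definition tensor_form ::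
    "'i set \<Rightarrow> 'b::complex_vector voa \<Rightarrow> ('i \<Rightarrow> ('a, 'w::complex_vector) vmodule)
      \<Rightarrow> ('i \<Rightarrow> 'w \<Rightarrow> 'w \<Rightarrow> complex) \<Rightarrow> ('b, 'c::complex_vector) vmodule
      \<Rightarrow> (('i \<Rightarrow> 'w) \<Rightarrow> 'c) \<Rightarrow> ('c \<Rightarrow> 'c \<Rightarrow> complex) \<Rightarrow> bool"
  where "tensor_form I VV M f W \<tau> F \<longleftrightarrow>
    invariant_form VV W F \<and> nondegenerate_on (mspace W) F \<and>
    (\<forall>a\<in>Pi\<^sub>E I (\<lambda>i. mspace (M i)). \<forall>b\<in>Pi\<^sub>E I (\<lambda>i. mspace (M i)).
      F (\<tau> a) (\<tau> b) = (\<Prod>i\<in>I. f i (a i) (b i)))"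

text \<open>\<open>VV = L(1/2,0)\<^sup>\<otimes>\<^sup>n\<close> and, for every \<open>H \<in> {0,1/2,1/16}\<^sup>n\<close>, the module \<open>W H = W\<^sub>H\<close> with its form
  \<open>F H\<close>; the pure tensors are given by \<open>\<tau>0\<close> and \<open>\<tau> H\<close>.\<close>

definition ising_tensor_modules ::
    "nat \<Rightarrow> 'a::complex_vector voa \<Rightarrow> (complex \<Rightarrow> ('a, 'a) vmodule)
      \<Rightarrow> (complex \<Rightarrow> 'a \<Rightarrow> 'a \<Rightarrow> complex)
      \<Rightarrow> 'b::complex_vector voa \<Rightarrow> ((nat \<Rightarrow> 'a) \<Rightarrow> 'b)
      \<Rightarrow> ((nat \<Rightarrow> complex) \<Rightarrow> ('b, 'c::complex_vector) vmodule)
      \<Rightarrow> ((nat \<Rightarrow> complex) \<Rightarrow> (nat \<Rightarrow> 'a) \<Rightarrow> 'c)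
      \<Rightarrow> ((nat \<Rightarrow> complex) \<Rightarrow> 'c \<Rightarrow> 'c \<Rightarrow> complex) \<Rightarrow> bool"
  where "ising_tensor_modules n V L f VV \<tau>0 W \<tau> F \<longleftrightarrow>
    tensor_voa (1/2) {1..n} V VV \<tau>0 \<and>
    (\<forall>H \<in> {1..n} \<rightarrow>\<^sub>E ising_weights.
      tensor_module (1/2) {1..n} V VV \<tau>0 (\<lambda>i. L (H i)) (W H) (\<tau> H) \<and>
      tensor_form {1..n} VV (\<lambda>i. L (H i)) (\<lambda>i. f (H i)) (W H) (\<tau> H) (F H))"

definition lowest_vector ::
    "nat \<Rightarrow> (complex \<Rightarrow> 'a) \<Rightarrow> ((nat \<Rightarrow> complex) \<Rightarrow> (nat \<Rightarrow> 'a) \<Rightarrow> 'c) \<Rightarrow> (nat \<Rightarrow> complex) \<Rightarrow> 'c"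
  where "lowest_vector n v \<tau> H = \<tau> H (\<lambda>i\<in>{1..n}. v (H i))"


section \<open>Codes\<close>

definition binary_linear_code :: "'i set \<Rightarrow> 'i set set \<Rightarrow> bool"
  where "binary_linear_code \<Omega> C \<longleftrightarrow>
    C \<subseteq> Pow \<Omega> \<and> {} \<in> C \<and> (\<forall>S\<in>C. \<forall>T\<in>C. (S - T) \<union> (T - S) \<in> C)"

definition even_code :: "'i set \<Rightarrow> 'i set set"
  where "even_code \<Omega> = {T \<in> Pow \<Omega>. even (card T)}"

definition code_conformal ::
    "nat \<Rightarrow> 'a voa \<Rightarrow> ((nat \<Rightarrow> 'a) \<Rightarrow> 'b::ab_group_add) \<Rightarrow> nat set \<Rightarrow> 'b"
  where "code_conformal n V \<tau>0 T =
    (\<Sum>i\<in>{1..n} - T. conformal_at {1..n} V \<tau>0 i) - (\<Sum>i\<in>T. conformal_at {1..n} V \<tau>0 i)"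

definition code_subring ::
    "nat \<Rightarrow> 'a voa \<Rightarrow> 'b::complex_vector voa \<Rightarrow> ((nat \<Rightarrow> 'a) \<Rightarrow> 'b) \<Rightarrow> nat set set \<Rightarrow> 'b set"
  where "code_subring n V VV \<tau>0 C = vertex_subring VV hull (code_conformal n V \<tau>0 ` C)"

definition generated_submodule ::
    "'v set \<Rightarrow> ('v, 'w::complex_vector) vmodule \<Rightarrow> 'w \<Rightarrow> 'w set"
  where "generated_submodule A W w = subring_module A W hull {w}"

end

theory Submission
  imports Defs
begin

text \<open>Write \<open>L\<^sub>T(m)\<close> for the modes of \<open>\<omega>\<^sub>T\<close>. The iterate formula and weak commutativity, both cases of the
  Jacobi identity with integral coefficients, reduce integrality of \<open>\<Y>\<close> to the coefficients
  \<open>S\<^sub>b\<close> of \<open>\<Y>(v\<^sub>1, x)v\<^sub>2\<close> on lowest weight vectors. Since \<open>L\<^sub>T(m)\<close> and \<open>L\<^sub>T(-m)\<close> are adjoint, \<open>S\<^sub>b\<close> lies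
  in the dual lattice as soon as every string of modes \<open>L\<^sub>T(m)\<close> applied to some \<open>S\<^sub>b\<close> pairs integrally
  with \<open>v\<^sub>3\<close>. The modes satisfy
  \<open>[L\<^sub>S(m), L\<^sub>T(k)] = (m - k) L\<^sub>S\<^sub>+\<^sub>T(m + k) + central term\<close>, where the central term is integral because
  \<open>4\<close> divides \<open>n\<close> and codewords are even. Eliminating the contribution of \<open>L\<^sub>T(-1)v\<^sub>1\<close> from two commutator
  formulas gives
  \<open>L\<^sub>T(m)S\<^sub>b = L\<^sub>T(0)S\<^sub>b\<^sub>+\<^sub>m + (m h\<^sub>T(v\<^sub>1) - h\<^sub>T(v\<^sub>2)) S\<^sub>b\<^sub>+\<^sub>m\<close> for \<open>m > 0\<close>, where \<open>h\<^sub>T\<close> denotes the eigenvalue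
  of \<open>L\<^sub>T(0)\<close>. This eigenvalue is an integer since \<open>L\<^sub>T(0)\<close> preserves the integral form. Induction on
  the length of the string leaves only the pairing of \<open>S\<^sub>b\<close> with \<open>v\<^sub>3\<close>.\<close>

section \<open>Linear algebra and additive subgroups\<close>

lemma scaleC_zero_right [simp]: "a *\<^sub>C (0::'a::complex_vector) = 0"
  by (rule cvs.scale_zero_right)

lemma scaleC_zero_left [simp]: "0 *\<^sub>C (x::'a::complex_vector) = 0"
  by (rule cvs.scale_zero_left)

lemma scaleC_one' [simp]: "1 *\<^sub>C (x::'a::complex_vector) = x"
  by (rule scaleC_one)

lemma linear_on_add: "linear_on S f \<Longrightarrow> x \<in> S \<Longrightarrow> y \<in> S \<Longrightarrow> f (x + y) = f x + f y"
  by (simp add: linear_on_def)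

lemma linear_on_scale: "linear_on S f \<Longrightarrow> x \<in> S \<Longrightarrow> f (a *\<^sub>C x) = a *\<^sub>C f x"
  by (simp add: linear_on_def)

lemma linear_on_0:
  assumes "linear_on S f" "cvs.subspace S" shows "f 0 = 0"
proof -
  have "f (0 *\<^sub>C 0) = 0 *\<^sub>C f 0"
    by (rule linear_on_scale[OF assms(1)]) (rule cvs.subspace_0[OF assms(2)])
  then show ?thesis by simp
qed

lemma linear_on_diff:
  assumes "linear_on S f" "cvs.subspace S" "x \<in> S" "y \<in> S"
  shows "f (x - y) = f x - f y"
  using linear_on_add[OF assms(1) cvs.subspace_diff[OF assms(2,3,4)] assms(4)] by simp

lemma linear_on_sum:
  assumes "linear_on S f" "cvs.subspace S" "\<And>i. i \<in> I \<Longrightarrow> x i \<in> S"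
  shows "f (\<Sum>i\<in>I. x i) = (\<Sum>i\<in>I. f (x i))"
  using assms(3)
proof (induction I rule: infinite_finite_induct)
  case (insert i I)
  have "(\<Sum>i\<in>I. x i) \<in> S" by (rule cvs.subspace_sum[OF assms(2)]) (use insert in auto)
  then show ?case using insert by (simp add: linear_on_add[OF assms(1)])
qed (use linear_on_0[OF assms(1,2)] in auto)

lemma linear_on_span_eq:
  assumes f: "linear_on (cvs.span B) f" and g: "linear_on (cvs.span B) g"
    and eq: "\<And>x. x \<in> B \<Longrightarrow> f x = g x" and x: "x \<in> cvs.span B"
  shows "f x = g x"
proof -
  \<comment> \<open>Membership is carried through the induction because linearity is known only on
    the span.\<close>
  have "x \<in> cvs.span B \<and> f x = g x"
    using x
  proof (induction rule: cvs.span_induct_alt)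
    case base
    show ?case
      using linear_on_0[OF f cvs.subspace_span] linear_on_0[OF g cvs.subspace_span]
      by (simp add: cvs.span_zero)
  next
    case (step c x y)
    have "x \<in> cvs.span B" using step by (simp add: cvs.span_base)
    then show ?case
      using step eq[OF step(1)] linear_on_add[OF f] linear_on_add[OF g]
        linear_on_scale[OF f] linear_on_scale[OF g]
      by (simp add: cvs.span_add cvs.span_scale)
  qed
  then show ?thesis ..
qed

lemma linear_on_lift:
  "linear_on S f \<Longrightarrow> linear_on S g \<Longrightarrow> linear_on S (\<lambda>x. f x + g x)"
  "linear_on S f \<Longrightarrow> linear_on S g \<Longrightarrow> linear_on S (\<lambda>x. f x - g x)"
  "linear_on S f \<Longrightarrow> linear_on S (\<lambda>x. a *\<^sub>C f x)"
  by (auto simp: linear_on_def scaleC_add_right scaleC_scaleC mult.commute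
      cvs.scale_right_diff_distrib)

lemma linear_on_compose:
  "linear_on S f \<Longrightarrow> f ` S \<subseteq> T \<Longrightarrow> linear_on T g \<Longrightarrow> linear_on S (\<lambda>x. g (f x))"
  by (auto simp: linear_on_def image_subset_iff)

lemma linear_on_const_0: "linear_on S (\<lambda>_. 0)"
  by (simp add: linear_on_def)

lemma linear_on_ident: "linear_on S (\<lambda>x. x)"
  by (simp add: linear_on_def)

section \<open>Multilinear maps\<close>

lemma multilinear_onD:
  "multilinear_on I X f \<Longrightarrow> w \<in> Pi\<^sub>E I X \<Longrightarrow> i \<in> I \<Longrightarrow> linear_on (X i) (\<lambda>a. f (w(i := a)))"
  by (simp add: multilinear_on_def)

lemma PiE_fun_upd: "w \<in> Pi\<^sub>E I X \<Longrightarrow> i \<in> I \<Longrightarrow> a \<in> X i \<Longrightarrow> w(i := a) \<in> Pi\<^sub>E I X"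
  by (auto simp: PiE_iff extensional_def)

lemma multilinear_on_scale:
  assumes "multilinear_on I X f" "w \<in> Pi\<^sub>E I X" "i \<in> I"
  shows "f (w(i := c *\<^sub>C w i)) = c *\<^sub>C f w"
proof -
  have "w i \<in> X i" using assms by auto
  from linear_on_scale[OF multilinear_onD[OF assms] this] show ?thesis by simp
qed

lemma multilinear_on_zero:
  assumes "multilinear_on I X f" "w \<in> Pi\<^sub>E I X" "i \<in> I" "w i = 0"
  shows "f w = 0"
  using multilinear_on_scale[OF assms(1,2,3), of 0] assms(4) by (simp add: fun_upd_idem)

text \<open>Enlarging one coordinate at a time from generators to their span keeps \<open>f\<close>
  zero, by linearity in that coordinate. Functionals on a tensor product can thus be tested on
  tensors of spanning vectors.\<close>

lemma multilinear_on_eq_0: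
  assumes fin: "finite I" and f: "multilinear_on I (\<lambda>i. cvs.span (E i)) f"
    and zero: "\<And>a. a \<in> Pi\<^sub>E I E \<Longrightarrow> f a = 0"
    and a: "a \<in> Pi\<^sub>E I (\<lambda>i. cvs.span (E i))"
  shows "f a = 0"
proof -
  \<comment> \<open>\<open>J\<close> is the set of coordinates already allowed to range over the
    full span.\<close>
  have "f a = 0" if "J \<subseteq> I" "a \<in> Pi\<^sub>E I (\<lambda>i. if i \<in> J then cvs.span (E i) else E i)" for J a
    using finite_subset[OF that(1) fin] that
  proof (induction J arbitrary: a rule: finite_induct)
    case empty
    then show ?case using zero by simp
  next
    case (insert j J)
    have j: "j \<in> I" using insert by auto
    have sp: "a \<in> Pi\<^sub>E I (\<lambda>i. cvs.span (E i))"
      using insert.prems(2) by (auto simp: PiE_iff cvs.span_base split: if_splits)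
    have lin: "linear_on (cvs.span (E j)) (\<lambda>x. f (a(j := x)))"
      by (rule multilinear_onD[OF f sp j])
    have "f (a(j := e)) = 0" if "e \<in> E j" for e
      using insert.prems that insert.hyps j
      by (intro insert.IH) (auto simp: PiE_iff extensional_def split: if_splits)
    from linear_on_span_eq[OF lin linear_on_const_0 this, of "a j"] sp j
    show ?case by auto
  qed
  from this[of I a] a show ?thesis by (auto simp: PiE_iff)
qed

section \<open>Additive subgroups and integral coefficients\<close>

lemma add_subgroupD:
  assumes "add_subgroup M"
  shows "0 \<in> M" "x \<in> M \<Longrightarrow> - x \<in> M" "x \<in> M \<Longrightarrow> y \<in> M \<Longrightarrow> x + y \<in> M"
    "x \<in> M \<Longrightarrow> y \<in> M \<Longrightarrow> x - y \<in> M"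
proof -
  show 0: "0 \<in> M" using assms by (simp add: add_subgroup_def)
  show diff: "x \<in> M \<Longrightarrow> y \<in> M \<Longrightarrow> x - y \<in> M" for x y
    using assms by (simp add: add_subgroup_def)
  show neg: "x \<in> M \<Longrightarrow> - x \<in> M" for x using diff[OF 0] by simp
  show "x \<in> M \<Longrightarrow> y \<in> M \<Longrightarrow> x + y \<in> M" using diff[of x "- y"] neg by simp
qed

lemma add_subgroup_Ints_scale:
  assumes M: "add_subgroup M" and "x \<in> M" "c \<in> \<int>"
  shows "c *\<^sub>C x \<in> M"
proof -
  have nat: "of_nat k *\<^sub>C x \<in> M" for k
    by (induction k) (auto simp: scaleC_add_left intro: add_subgroupD[OF M] assms(2))
  from \<open>c \<in> \<int>\<close> obtain k where "c = of_int k" by (auto elim: Ints_cases)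
  then show ?thesis
    using nat[of "nat k"] nat[of "nat (- k)"] add_subgroupD(2)[OF M, of "of_nat (nat (- k)) *\<^sub>C x"]
    by (cases "k \<ge> 0") auto
qed

lemma add_subgroup_sum:
  "add_subgroup M \<Longrightarrow> (\<And>i. i \<in> I \<Longrightarrow> g i \<in> M) \<Longrightarrow> sum g I \<in> M"
  by (induction I rule: infinite_finite_induct) (auto intro: add_subgroupD)

lemma add_subgroup_Sum_any:
  "add_subgroup M \<Longrightarrow> (\<And>i. g i \<in> M) \<Longrightarrow> Sum_any g \<in> M"
  by (simp add: Sum_any.expand_set add_subgroup_sum)

lemma add_subgroup_subspace: "cvs.subspace S \<Longrightarrow> add_subgroup S"
  by (simp add: add_subgroup_def cvs.subspace_0 cvs.subspace_diff)

text \<open>A negative upper argument is reflected by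
  \<open>(l gchoose k) = (-1)^k * ((k - l - 1) gchoose k)\<close>, where \<open>k - l - 1\<close> is
  a natural number. Hence all binomial coefficients in the Jacobi identity are integers.\<close>

lemma gbinomial_Ints: "((of_int l :: complex) gchoose k) \<in> \<int>"
proof (cases "l \<ge> 0")
  case True
  then obtain m where "l = int m" by (metis nonneg_int_cases)
  then show ?thesis by (simp flip: binomial_gbinomial)
next
  case False
  then obtain m where "int k - l - 1 = int m" 
    using False by (intro that[of "nat (int k - l - 1)"]) simp
  then have "of_nat k - of_int l - 1 = (of_nat m :: complex)"
    by (metis of_int_1 of_int_diff of_int_of_nat_eq)
  then show ?thesis
    by (simp add: gbinomial_negated_upper[of "of_int l"] flip: binomial_gbinomial)
qed

lemma neg_one_powi_Ints: "((- 1) powi l :: complex) \<in> \<int>"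
  by (auto simp: power_int_def)

text \<open>The vectors with integral \<open>B\<close>-coordinates form an additive subgroup
  containing \<open>B\<close>.\<close>

lemma representation_int_span:
  assumes B: "cvs.independent B" and x: "x \<in> int_span B"
  shows "x \<in> cvs.span B \<and> (\<forall>b. cvs.representation B x b \<in> \<int>)"
proof -
  let ?S = "{x \<in> cvs.span B. \<forall>b. cvs.representation B x b \<in> \<int>}"
  have "int_span B \<subseteq> ?S"
  proof (rule hull_minimal)
    show "B \<subseteq> ?S"
      using B by (auto simp: cvs.span_base cvs.representation_basis)
    show "add_subgroup ?S"
      using B by (auto simp: add_subgroup_def cvs.span_zero cvs.span_diff
          cvs.representation_zero cvs.representation_diff)
  qed
  with x show ?thesis by blast
qed

text \<open>With \<open>q = a / b\<close> in lowest terms, \<open>b ^ k\<close> divides the fixed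
  nonzero integer \<open>c\<close> for every \<open>k\<close>, which forces
  \<open>b = 1\<close>.\<close>

lemma Rats_powers_Ints:
  fixes q c :: "'a::field_char_0"
  assumes q: "q \<in> \<rat>" and c: "c \<in> \<int>" "c \<noteq> 0" and pow: "\<And>k. q ^ k * c \<in> \<int>"
  shows "q \<in> \<int>"
proof -
  obtain a b where ab: "b > 0" "coprime a b" "q = of_int a / of_int b"
    using Rats_cases'[OF q] .
  obtain d where d: "c = of_int d" using c(1) by (rule Ints_cases)
  have dvd: "b ^ k dvd d" for k
  proof -
    obtain e where "q ^ k * c = of_int e" using pow by (rule Ints_cases)
    then have "(of_int (a ^ k * d) :: 'a) = of_int (e * b ^ k)"
      using ab by (simp add: d power_divide field_simps)
    then have "a ^ k * d = e * b ^ k" by (simp only: of_int_eq_iff)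
    then have "b ^ k dvd a ^ k * d" by simp
    moreover have "coprime (b ^ k) (a ^ k)" using ab by (simp add: coprime_commute)
    ultimately show ?thesis by (simp add: coprime_dvd_mult_right_iff)
  qed
  have "b = 1"
  proof (rule ccontr)
    assume "b \<noteq> 1"
    with ab have "b \<ge> 2" by simp
    \<comment> \<open>The absolute value of \<open>d\<close> serves as exponent because
      \<open>2 ^ k > k\<close>.\<close>
    then have "2 ^ nat \<bar>d\<bar> \<le> b ^ nat \<bar>d\<bar>" by (intro power_mono) auto
    also have "\<dots> \<le> \<bar>d\<bar>"
      using dvd_imp_le_int[OF _ dvd[of "nat \<bar>d\<bar>"]] c d ab by auto
    finally have "(2::int) ^ nat \<bar>d\<bar> \<le> int (nat \<bar>d\<bar>)" by simp
    moreover have "int (nat \<bar>d\<bar>) < 2 ^ nat \<bar>d\<bar>" using of_nat_less_two_power .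
    ultimately show False by linarith
  qed
  then show ?thesis using ab by simp
qed

text \<open>The coefficients of \<open>x\<close> in an integral basis are integers that stay integral after
  multiplication by all powers of \<open>q\<close>.\<close>

lemma integral_form_eigenvalue_Ints:
  assumes "module_integral_form V A W M" and x: "x \<in> M" "x \<noteq> 0" and q: "q \<in> \<rat>"
    and pow: "\<And>k. q ^ k *\<^sub>C x \<in> M"
  shows "q \<in> \<int>"
proof -
  obtain B where B: "cvs.independent B" "M = int_span B"
    using assms(1) by (auto simp: module_integral_form_def)
  have sp: "x \<in> cvs.span B" using representation_int_span[OF B(1)] x B by auto
  obtain b where b: "cvs.representation B x b \<noteq> 0"
  proof -
    have "\<exists>b. cvs.representation B x b \<noteq> 0"
    proof (rule ccontr)
      assume no: "\<not> ?thesis"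
      then have "cvs.representation B x = cvs.representation B 0"
        by (auto simp: cvs.representation_zero)
      then show False
        using cvs.representation_eqI[OF B(1)] cvs.sum_nonzero_representation_eq[OF B(1) sp] x
          no by simp
    qed
    then show ?thesis using that by blast
  qed
  show ?thesis
  proof (rule Rats_powers_Ints[OF q _ b])
    show "cvs.representation B x b \<in> \<int>" using representation_int_span[OF B(1)] x B by auto
    fix k
    have "cvs.representation B (q ^ k *\<^sub>C x) b \<in> \<int>"
      using representation_int_span[OF B(1)] pow[of k] B by auto
    then show "q ^ k * cvs.representation B x b \<in> \<int>"
      by (simp add: cvs.representation_scale[OF B(1) sp])
  qed
qed

section \<open>Vertex maps and integrality\<close>

lemma vertex_mapD:
  assumes "vertex_map V W1 W2 W3 Y"
  shows "\<And>w1 w2 b. w1 \<in> mspace W1 \<Longrightarrow> w2 \<in> mspace W2 \<Longrightarrow> Y w1 b w2 \<in> mspace W3"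
    and "\<And>w1 b. w1 \<in> mspace W1 \<Longrightarrow> linear_on (mspace W2) (Y w1 b)"
    and "\<And>w2 b. w2 \<in> mspace W2 \<Longrightarrow> linear_on (mspace W1) (\<lambda>w1. Y w1 b w2)"
    and "\<And>w1 w2 b. w1 \<in> mspace W1 \<Longrightarrow> w2 \<in> mspace W2 \<Longrightarrow> \<exists>N. \<forall>k\<ge>N. Y w1 (b + of_nat k) w2 = 0"
    and "\<And>v w1 w2 l m b. v \<in> mspace V \<Longrightarrow> w1 \<in> mspace W1 \<Longrightarrow> w2 \<in> mspace W2 \<Longrightarrow>
      Sum_any (\<lambda>i::nat. ((-1) ^ i * ((of_int l :: complex) gchoose i)) *\<^sub>C
        (action W3 v (m + l - int i) (Y w1 (b + of_nat i) w2)
          - ((-1) powi l) *\<^sub>C Y w1 (b + of_int l - of_nat i) (action W2 v (m + int i) w2)))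
      = Sum_any (\<lambda>i::nat. ((of_int m :: complex) gchoose i) *\<^sub>C
          Y (action W1 v (l + int i) w1) (of_int m + b - of_nat i) w2)"
  using assms by (auto simp: vertex_map_def bilinear_on_def jacobi_def)

lemma voa_moduleD:
  assumes "voa_module c V W"
  shows "cvs.subspace (mspace W)" "vertex_map V V W W (action W)"
    "\<And>w m. w \<in> mspace W \<Longrightarrow> action W (vacuum V) m w = (if m = -1 then w else 0)"
    "virasoro_relations c (mspace W) (virL V W)"
  using assms by (auto simp: voa_module_def)

lemma voa_module_truncation:
  assumes W: "voa_module c V W" and "u \<in> mspace V" "w \<in> mspace W"
  obtains N where "\<And>m. m \<ge> N \<Longrightarrow> action W u m w = 0"
proof -
  obtain K where K: "\<forall>k\<ge>K. action W u (0 + of_nat k) w = 0"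
    using vertex_mapD(4)[OF voa_moduleD(2)[OF W] assms(2,3)] by blast
  have "action W u m w = 0" if "m \<ge> int K" for m
    using K[rule_format, of "nat m"] that by (simp add: le_nat_iff)
  then show ?thesis by (rule that)
qed

text \<open>The Jacobi identity at \<open>m = 0\<close> expresses the modes of \<open>Y(u\<^sub>l w\<^sub>1, x)\<close> by those of \<open>u\<close> and of
  \<open>Y(w\<^sub>1, x)\<close>.\<close>

lemma vertex_map_iterate_mem:
  assumes Y: "vertex_map V W1 W2 W3 Y" and M: "add_subgroup M"
    and u: "u \<in> mspace V" and w: "w1 \<in> mspace W1" "w2 \<in> mspace W2"
    and "\<And>m b. action W3 u m (Y w1 b w2) \<in> M"
    and "\<And>m b. Y w1 b (action W2 u m w2) \<in> M"
  shows "Y (action W1 u l w1) b w2 \<in> M"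
proof -
  have "Sum_any (\<lambda>i::nat. ((-1) ^ i * ((of_int l :: complex) gchoose i)) *\<^sub>C
        (action W3 u (0 + l - int i) (Y w1 (b + of_nat i) w2)
          - ((-1) powi l) *\<^sub>C Y w1 (b + of_int l - of_nat i) (action W2 u (0 + int i) w2))) \<in> M"
    (is "?lhs \<in> M")
    by (intro add_subgroup_Sum_any[OF M] add_subgroup_Ints_scale[OF M] add_subgroupD[OF M] assms
        Ints_mult Ints_power Ints_minus Ints_1 gbinomial_Ints neg_one_powi_Ints)
  moreover have "?lhs = Sum_any (\<lambda>i::nat. ((of_int 0 :: complex) gchoose i) *\<^sub>C
      Y (action W1 u (l + int i) w1) (of_int 0 + b - of_nat i) w2)"
    by (rule vertex_mapD(5)[OF Y u w])
  moreover have "\<dots> = Sum_any (\<lambda>i::nat. if i = 0 then Y (action W1 u l w1) b w2 else 0)"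
    by (rule arg_cong[where f = Sum_any]) (auto simp: gbinomial_0_left)
  moreover have "\<dots> = Y (action W1 u l w1) b w2"
    by (rule Sum_any.delta)
  ultimately show ?thesis by (simp only:)
qed

text \<open>Weak commutativity: for large \<open>l\<close> the right-hand side of the Jacobi identity vanishes, and
  \<open>Y(w\<^sub>1, x) u\<^sub>m w\<^sub>2\<close> is expressed by \<open>Y(w\<^sub>1, x) w\<^sub>2\<close> and by \<open>Y(w\<^sub>1, x) u\<^sub>k w\<^sub>2\<close> with \<open>k > m\<close>.\<close>

lemma vertex_map_commute_mem:
  assumes Y: "vertex_map V W1 W2 W3 Y" and M: "add_subgroup M"
    and W1: "voa_module c1 V W1" and W2: "voa_module c2 V W2"
    and u: "u \<in> mspace V" and w: "w1 \<in> mspace W1" "w2 \<in> mspace W2"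
    and act: "\<And>m b. action W3 u m (Y w1 b w2) \<in> M"
  shows "Y w1 b (action W2 u m w2) \<in> M"
proof -
  obtain N1 where N1: "\<And>m. m \<ge> N1 \<Longrightarrow> action W1 u m w1 = 0"
    using voa_module_truncation[OF W1 u w(1)] by blast
  obtain N2 where N2: "\<And>m. m \<ge> N2 \<Longrightarrow> action W2 u m w2 = 0"
    using voa_module_truncation[OF W2 u w(2)] by blast
  define l where "l = nat N1"
  have Y0: "Y 0 b w2 = 0" for b
    using linear_on_0[OF vertex_mapD(3)[OF Y w(2)] voa_moduleD(1)[OF W1]] .
  have Y0': "Y w1 b 0 = 0" for b
    using linear_on_0[OF vertex_mapD(2)[OF Y w(1)] voa_moduleD(1)[OF W2]] .
  \<comment> \<open>Downward induction on the mode, starting at \<open>N2\<close>, from where on all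
    modes of \<open>u\<close> kill \<open>w2\<close>.\<close>
  have "Y w1 b (action W2 u (N2 - int k) w2) \<in> M" for k b
  proof (induction k arbitrary: b rule: less_induct)
    case (less k)
    define m where "m = N2 - int k"
    \<comment> \<open>The shift by \<open>l\<close> makes the term \<open>i = 0\<close> of the
      Jacobi identity contain \<open>Y w1 b\<close> itself.\<close>
    define b' where "b' = b - of_nat l"
    have higher: "Y w1 b (action W2 u (m + int i) w2) \<in> M" if "i > 0" for i b
    proof (cases "i \<le> k")
      case True
      then have "m + int i = N2 - int (k - i)" by (simp add: m_def)
      then show ?thesis using less[of "k - i" b] that True by (simp only:)
    next
      case False
      then show ?thesis using N2[of "m + int i"] Y0' add_subgroupD(1)[OF M] by (simp add: m_def)
    qed
    define g where "g i = ((-1) ^ i * ((of_int (int l) :: complex) gchoose i)) *\<^sub>C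
        (action W3 u (m + int l - int i) (Y w1 (b' + of_nat i) w2)
          - ((-1) powi int l) *\<^sub>C Y w1 (b' + of_int (int l) - of_nat i) (action W2 u (m + int i) w2))"
      for i
    have supp: "{i. g i \<noteq> 0} \<subseteq> {..l}"
      unfolding g_def by (auto simp flip: binomial_gbinomial intro: ccontr)
    have "Sum_any g = 0"
      using vertex_mapD(5)[OF Y u w, of "int l" m b'] N1 Y0 by (simp add: g_def l_def)
    then have "0 = g 0 + (\<Sum>i\<in>{0<..l}. g i)"
      using Sum_any.expand_superset[OF _ supp] by (simp add: sum.head flip: atLeast0AtMost)
    moreover have "(\<Sum>i\<in>{0<..l}. g i) \<in> M"
      unfolding g_def
      by (intro add_subgroup_sum[OF M] add_subgroup_Ints_scale[OF M] add_subgroupD[OF M] act higher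
        Ints_mult Ints_power Ints_minus Ints_1 gbinomial_Ints neg_one_powi_Ints) auto
    ultimately have g0: "g 0 \<in> M"
      using add_subgroupD(2)[OF M] by (metis add.commute add_eq_0_iff)
    define A where "A = action W3 u (m + int l) (Y w1 b' w2)"
    define s where "s = ((-1) powi int l :: complex)"
    have A: "A \<in> M" unfolding A_def by (rule act)
    have ss: "s * s = 1" unfolding s_def by (simp flip: power_mult_distrib)
    have "g 0 = A - s *\<^sub>C Y w1 b (action W2 u m w2)"
      by (simp add: g_def A_def s_def b'_def)
    then have "Y w1 b (action W2 u m w2) = s *\<^sub>C (A - g 0)"
      using ss by (simp add: scaleC_scaleC)
    also have "\<dots> \<in> M"
      unfolding s_def
      by (intro add_subgroup_Ints_scale[OF M] add_subgroupD(4)[OF M] A g0 neg_one_powi_Ints)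
    finally show ?case unfolding m_def .
  qed
  from this[of b "nat (N2 - m)"] show ?thesis
  proof (cases "m \<le> N2")
    case False
    then show ?thesis using N2[of m] Y0' add_subgroupD(1)[OF M] by simp
  qed simp
qed

text \<open>The iterate formula, applied to the module itself, writes the modes of a product as
  integral combinations of composed modes of the factors, so elements preserving \<open>M\<close>
  are closed under products.\<close>

lemma vertex_subring_stabilizer:
  assumes V: "is_voa c V" and W: "voa_module c' V W"
    and M: "M \<subseteq> mspace W" "add_subgroup M"
  shows "vertex_subring V {u \<in> mspace V. \<forall>m. \<forall>w\<in>M. action W u m w \<in> M}"
    (is "vertex_subring V ?S")
proof -
  have VV: "voa_module c V V" and vac: "vacuum V \<in> mspace V"
    using V by (auto simp: is_voa_def wt_space_def)
  note subsp = voa_moduleD(1)[OF VV] and vm = voa_moduleD(2)[OF W]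
  have "vacuum V \<in> ?S"
    using vac M add_subgroupD(1)[OF M(2)] voa_moduleD(3)[OF W] by auto
  moreover have "add_subgroup ?S"
    unfolding add_subgroup_def
  proof (intro conjI ballI)
    show "0 \<in> ?S"
      using linear_on_0[OF vertex_mapD(3)[OF vm] subsp] M add_subgroupD(1)[OF M(2)]
        cvs.subspace_0[OF subsp] by auto
    fix x y assume "x \<in> ?S" "y \<in> ?S"
    then show "x - y \<in> ?S"
      using linear_on_diff[OF vertex_mapD(3)[OF vm] subsp] M add_subgroupD(4)[OF M(2)]
        cvs.subspace_diff[OF subsp] by auto
  qed
  moreover have "action V u l v \<in> ?S" if "u \<in> ?S" "v \<in> ?S" for u v l
  proof -
    have "action W (action V u l v) b w \<in> M" if w: "w \<in> M" for b w
      using that \<open>u \<in> ?S\<close> \<open>v \<in> ?S\<close> M(1)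
      by (intro vertex_map_iterate_mem[OF vm M(2), of u v w]) auto
    then show ?thesis using that vertex_mapD(1)[OF voa_moduleD(2)[OF VV]] by auto
  qed
  ultimately show ?thesis by (auto simp: vertex_subring_def)
qed

text \<open>Stability needs to be tested on generators only, since the stabilizer of
  \<open>M\<close> is a vertex subring.\<close>

lemma subring_module_hull:
  assumes "is_voa c V" "voa_module c' V W" "M \<subseteq> mspace W" "add_subgroup M" "G \<subseteq> mspace V"
    and "\<And>u m w. u \<in> G \<Longrightarrow> w \<in> M \<Longrightarrow> action W u m w \<in> M"
  shows "subring_module (vertex_subring V hull G) W M"
proof -
  have "vertex_subring V hull G \<subseteq> {u \<in> mspace V. \<forall>m. \<forall>w\<in>M. action W u m w \<in> M}"
    using assms(5,6) by (intro hull_minimal vertex_subring_stabilizer[OF assms(1-4)]) auto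
  then show ?thesis using assms(3,4) by (auto simp: subring_module_def)
qed

lemma vertex_subring_hull_subset:
  assumes "is_voa c V" "G \<subseteq> mspace V"
  shows "vertex_subring V hull G \<subseteq> mspace V"
proof (rule hull_minimal[OF assms(2)])
  have VV: "voa_module c V V" and vac: "vacuum V \<in> mspace V"
    using assms(1) by (auto simp: is_voa_def wt_space_def)
  then show "vertex_subring V (mspace V)"
    using vertex_mapD(1)[OF voa_moduleD(2)[OF VV]] add_subgroup_subspace[OF voa_moduleD(1)[OF VV]]
    by (auto simp: vertex_subring_def)
qed

text \<open>Integrality spreads from the two generators in two stages: weak commutativity extends it
  from \<open>w2\<close> to the submodule generated by \<open>w2\<close>, then the iterate formula
  extends it in the first argument.\<close>

lemma integral_intertwining_generated:
  assumes Y: "vertex_map V W1 W2 W3 Y" and W1: "voa_module c1 V W1" and W2: "voa_module c2 V W2"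
    and W3: "voa_module c3 V W3"
    and A: "A \<subseteq> mspace V" and M3: "subring_module A W3 M3"
    and w: "w1 \<in> mspace W1" "w2 \<in> mspace W2"
    and gen: "\<And>b. Y w1 b w2 \<in> M3"
    and M2: "subring_module A W2 (generated_submodule A W2 w2)"
  shows "integral_intertwining (generated_submodule A W1 w1) (generated_submodule A W2 w2) M3 Y"
proof -
  have sub: "add_subgroup M3" and act3: "\<And>u m w. u \<in> A \<Longrightarrow> w \<in> M3 \<Longrightarrow> action W3 u m w \<in> M3"
    using M3 by (auto simp: subring_module_def)
  note sp1 = voa_moduleD(1)[OF W1] and sp2 = voa_moduleD(1)[OF W2]
  have "generated_submodule A W2 w2 \<subseteq> {y \<in> mspace W2. \<forall>b. Y w1 b y \<in> M3}" (is "_ \<subseteq> ?S2")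
    unfolding generated_submodule_def
  proof (rule hull_minimal)
    show "{w2} \<subseteq> ?S2" using w gen by simp
    have "action W2 u m y \<in> ?S2" if "u \<in> A" "y \<in> ?S2" for u m y
      using vertex_map_commute_mem[OF Y sub W1 W2, of u w1 y] that A w act3
        vertex_mapD(1)[OF voa_moduleD(2)[OF W2], of u y m] by auto
    then show "subring_module A W2 ?S2"
      using linear_on_0[OF vertex_mapD(2)[OF Y w(1)] sp2] add_subgroupD[OF sub]
        linear_on_diff[OF vertex_mapD(2)[OF Y w(1)] sp2] cvs.subspace_diff[OF sp2]
        cvs.subspace_0[OF sp2]
      by (auto simp: subring_module_def add_subgroup_def)
  qed
  then have S2: "Y w1 b y \<in> M3" "y \<in> mspace W2" if "y \<in> generated_submodule A W2 w2" for b y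
    using that by auto
  let ?M2 = "generated_submodule A W2 w2"
  \<comment> \<open>The second argument ranges over the whole submodule here, since the iterate
    formula moves modes onto it.\<close>
  have "generated_submodule A W1 w1 \<subseteq> {x \<in> mspace W1. \<forall>y\<in>?M2. \<forall>b. Y x b y \<in> M3}" (is "_ \<subseteq> ?S1")
    unfolding generated_submodule_def[of A W1]
  proof (rule hull_minimal)
    show "{w1} \<subseteq> ?S1" using w S2 by simp
    have "action W1 u m x \<in> ?S1" if "u \<in> A" "x \<in> ?S1" for u m x
    proof -
      have "Y (action W1 u m x) b y \<in> M3" if y: "y \<in> ?M2" for y b
        using \<open>u \<in> A\<close> \<open>x \<in> ?S1\<close> A S2(2)[OF y] y act3 M2
        by (intro vertex_map_iterate_mem[OF Y sub]) (auto simp: subring_module_def)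
      then show ?thesis
        using that A vertex_mapD(1)[OF voa_moduleD(2)[OF W1], of u x m] by auto
    qed
    then show "subring_module A W1 ?S1"
      using linear_on_0[OF vertex_mapD(3)[OF Y S2(2)] sp1] add_subgroupD[OF sub]
        linear_on_diff[OF vertex_mapD(3)[OF Y S2(2)] sp1] cvs.subspace_diff[OF sp1]
        cvs.subspace_0[OF sp1]
      by (auto simp: subring_module_def add_subgroup_def)
  qed
  then show ?thesis by (auto simp: integral_intertwining_def)
qed

text \<open>This is the Jacobi identity at \<open>l = 0\<close>, where only \<open>i = 0\<close>
  survives on the left.\<close>

lemma vertex_map_commutator:
  assumes Y: "vertex_map V W1 W2 W3 Y" and u: "u \<in> mspace V"
    and w: "w1 \<in> mspace W1" "w2 \<in> mspace W2"
  shows "action W3 u m (Y w1 b w2) - Y w1 b (action W2 u m w2)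
    = Sum_any (\<lambda>i::nat. ((of_int m :: complex) gchoose i) *\<^sub>C
          Y (action W1 u (int i) w1) (of_int m + b - of_nat i) w2)"
proof -
  have "Sum_any (\<lambda>i::nat. ((-1) ^ i * ((of_int 0 :: complex) gchoose i)) *\<^sub>C
        (action W3 u (m + 0 - int i) (Y w1 (b + of_nat i) w2)
          - ((-1) powi 0) *\<^sub>C Y w1 (b + of_int 0 - of_nat i) (action W2 u (m + int i) w2)))
     = Sum_any (\<lambda>i::nat. if i = 0 then action W3 u m (Y w1 b w2) - Y w1 b (action W2 u m w2) else 0)"
    by (rule arg_cong[where f = Sum_any]) (auto simp: gbinomial_0_left)
  moreover have "\<dots> = action W3 u m (Y w1 b w2) - Y w1 b (action W2 u m w2)"
    by (rule Sum_any.delta)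
  ultimately show ?thesis using vertex_mapD(5)[OF Y u w, of 0 m b] by (simp only: add_0)
qed

section \<open>Invariant forms\<close>

text \<open>As \<open>L(1)u = 0\<close>, the exponential in the invariance condition reduces to its
  constant term. For weight 2 the resulting adjoint exchanges the modes \<open>L(m)\<close> and
  \<open>L(-m)\<close>.\<close>

lemma invariant_form_quasi_primary:
  assumes F: "invariant_form V W F" and V: "is_voa c V" and W: "voa_module c' V W"
    and u: "u \<in> wt_space V V (of_int k)" "virL V V 1 u = 0"
    and w: "w' \<in> mspace W" "w \<in> mspace W"
  shows "F (action W u m w') w = (-1) powi k * F w' (action W u (2 * k - m - 2) w)"
proof -
  have VV: "voa_module c V V" and om: "conformal V \<in> mspace V"
    using V by (auto simp: is_voa_def wt_space_def)
  note vm = voa_moduleD(2)[OF W] and sp = voa_moduleD(1)[OF W]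
  have L0: "virL V V 1 0 = 0"
    unfolding virL_def
    by (rule linear_on_0[OF vertex_mapD(2)[OF voa_moduleD(2)[OF VV] om] voa_moduleD(1)[OF VV]])
  have pow: "(virL V V 1 ^^ Suc j) u = 0" for j
    by (induction j) (use u L0 in auto)
  have act0: "action W 0 m w = 0" for m
    by (rule linear_on_0[OF vertex_mapD(3)[OF vm w(2)] voa_moduleD(1)[OF VV]])
  have F0: "F w' 0 = 0"
    using F w by (intro linear_on_0[OF _ sp]) (auto simp: invariant_form_def bilinear_on_def)
  have "F (action W u m w') w = (-1) powi k * Sum_any (\<lambda>j::nat.
        F w' (action W ((virL V V 1 ^^ j) u) (2 * k - m - 2 - int j) w) / fact j)"
    using F u(1) w by (auto simp: invariant_form_def)
  also have "Sum_any (\<lambda>j::nat.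
        F w' (action W ((virL V V 1 ^^ j) u) (2 * k - m - 2 - int j) w) / fact j)
    = Sum_any (\<lambda>j::nat. if j = 0 then F w' (action W u (2 * k - m - 2) w) else 0)"
  proof (rule arg_cong[where f = Sum_any], rule ext)
    fix j
    show "F w' (action W ((virL V V 1 ^^ j) u) (2 * k - m - 2 - int j) w) / fact j
      = (if j = 0 then F w' (action W u (2 * k - m - 2) w) else 0)"
      using pow act0 F0 by (cases j) (auto simp del: funpow.simps(2) simp: of_nat_Suc)
  qed
  also have "\<dots> = F w' (action W u (2 * k - m - 2) w)"
    by (rule Sum_any.delta)
  finally show ?thesis .
qed

section \<open>Virasoro operators on tensor products\<close>

lemma virasoro_relationsD:
  "virasoro_relations c S L \<Longrightarrow> w \<in> S \<Longrightarrow> L m (L n w) - L n (L m w) =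
      of_int (m - n) *\<^sub>C L (m + n) w
      + (if m + n = 0 then (of_int (m ^ 3 - m) / 12 * c) *\<^sub>C w else 0)"
  by (simp add: virasoro_relations_def)

text \<open>The record schemes of \<open>M\<close> and \<open>W\<close> also admit the algebras
  themselves, so the same results describe \<open>VV\<close> acting on itself and on its tensor
  product modules.\<close>

locale voa_tensor_product =
  fixes I :: "'i set" and c c' c'' :: complex
    and V :: "'a::complex_vector voa" and VV :: "'b::complex_vector voa"
    and \<tau>0 :: "('i \<Rightarrow> 'a) \<Rightarrow> 'b"
    and M :: "'i \<Rightarrow> ('a, 'w::complex_vector, 'z) vmodule_scheme"
    and W :: "('b, 'c::complex_vector, 'z2) vmodule_scheme"
    and \<tau> :: "('i \<Rightarrow> 'w) \<Rightarrow> 'c"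
  assumes finite_I: "finite I"
    and V: "is_voa c V" and VV: "is_voa c' VV"
    and tensor_VV: "tensor_space I (\<lambda>_. mspace V) (mspace VV) \<tau>0"
    and M: "\<And>i. i \<in> I \<Longrightarrow> voa_module c V (M i)"
    and W: "voa_module c'' VV W"
    and tensor_W: "tensor_space I (\<lambda>i. mspace (M i)) (mspace W) \<tau>"
    and act_W: "tensor_action I V M \<tau>0 \<tau> W"
begin

abbreviation pure :: "('i \<Rightarrow> 'w) set"
  where "pure \<equiv> Pi\<^sub>E I (\<lambda>i. mspace (M i))"

lemma conformal_V: "conformal V \<in> mspace V" and vacuum_V: "vacuum V \<in> mspace V"
  using V by (auto simp: is_voa_def wt_space_def)

lemma virL_M_closed: "i \<in> I \<Longrightarrow> w \<in> mspace (M i) \<Longrightarrow> virL V (M i) m w \<in> mspace (M i)"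
  unfolding virL_def by (rule vertex_mapD(1)[OF voa_moduleD(2)[OF M] conformal_V])

lemma conformal_at_closed: "conformal_at I V \<tau>0 i \<in> mspace VV"
proof -
  have "(\<lambda>j\<in>I. if j = i then conformal V else vacuum V) \<in> Pi\<^sub>E I (\<lambda>_. mspace V)"
    using conformal_V vacuum_V by auto
  then show ?thesis
    using tensor_VV by (auto simp: conformal_at_def tensor_space_def intro: cvs.span_base)
qed

text \<open>The Virasoro mode \<open>L(m)\<close> of the \<open>i\<close>-th tensor factor; the
  index shift comes from \<open>Y(\<omega>,x)\<close> having \<open>L(m)\<close> at the power
  \<open>-m-2\<close>.\<close>

definition D :: "'i \<Rightarrow> int \<Rightarrow> 'c \<Rightarrow> 'c"
  where "D i m w = action W (conformal_at I V \<tau>0 i) (m + 1) w"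

lemma subspace_W: "cvs.subspace (mspace W)"
  by (rule voa_moduleD(1)[OF W])

lemma D_closed: "w \<in> mspace W \<Longrightarrow> D i m w \<in> mspace W"
  unfolding D_def by (rule vertex_mapD(1)[OF voa_moduleD(2)[OF W] conformal_at_closed])

lemma linear_D: "linear_on (mspace W) (D i m)"
  unfolding D_def by (rule vertex_mapD(2)[OF voa_moduleD(2)[OF W] conformal_at_closed])

lemma multilinear_tau: "multilinear_on I (\<lambda>i. mspace (M i)) \<tau>"
  and W_span: "mspace W = cvs.span (\<tau> ` pure)"
  using tensor_W by (auto simp: tensor_space_def)

lemma tau_closed: "a \<in> pure \<Longrightarrow> \<tau> a \<in> mspace W"
  using W_span by (auto intro: cvs.span_base)

text \<open>The vacuum vectors force all modes but the \<open>i\<close>-th to be \<open>-1\<close>.\<close>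

lemma D_pure:
  assumes i: "i \<in> I" and a: "a \<in> pure"
  shows "D i m (\<tau> a) = \<tau> (a(i := virL V (M i) m (a i)))"
proof -
  define u where "u = (\<lambda>j\<in>I. if j = i then conformal V else vacuum V)"
  have u: "u \<in> Pi\<^sub>E I (\<lambda>_. mspace V)"
    using conformal_V vacuum_V by (auto simp: u_def)
  define k0 :: "'i \<Rightarrow> int" where "k0 = (\<lambda>j\<in>I. if j = i then m + 1 else - 1)"
  define K where "K = {k \<in> I \<rightarrow>\<^sub>E (UNIV :: int set). (\<Sum>i\<in>I. - k i - 1) = - (m + 1) - 1 \<and>
                  (\<forall>i\<in>I. action (M i) (u i) (k i) (a i) \<noteq> 0)}"
  define b where "b = a(i := virL V (M i) m (a i))"
  have b: "b \<in> pure"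
    unfolding b_def using a i by (intro PiE_fun_upd) (auto intro: virL_M_closed)
  have act_b: "(\<lambda>j\<in>I. action (M j) (u j) (k0 j) (a j)) = b"
  proof
    fix j show "(\<lambda>j\<in>I. action (M j) (u j) (k0 j) (a j)) j = b j"
      using a i voa_moduleD(3)[OF M, of j "a j"]
      by (cases "j \<in> I") (auto simp: k0_def u_def b_def virL_def PiE_iff extensional_def)
  qed
  have sum_k: "(\<Sum>j\<in>I. - k j - 1) = - k i - 1" if "\<And>j. j \<in> I \<Longrightarrow> j \<noteq> i \<Longrightarrow> k j = - 1" for k :: "'i \<Rightarrow> int"
    using that by (subst sum.remove[OF finite_I i]) auto
  have sub: "K \<subseteq> {k0}"
  proof
    fix k assume k: "k \<in> K"
    have kj: "k j = - 1" if "j \<in> I" "j \<noteq> i" for j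
    proof -
      have "action (M j) (vacuum V) (k j) (a j) \<noteq> 0"
        using k that by (auto simp: K_def u_def)
      then show ?thesis using voa_moduleD(3)[OF M, of j "a j"] that a by (auto simp: PiE_iff split: if_splits)
    qed
    then have "k i = m + 1" using sum_k[of k] k by (auto simp: K_def)
    then have "k = k0" using kj k by (auto simp: K_def k0_def PiE_iff extensional_def fun_eq_iff)
    then show "k \<in> {k0}" by simp
  qed
  have k0_iff: "k0 \<in> K \<longleftrightarrow> (\<forall>j\<in>I. b j \<noteq> 0)"
    using sum_k[of k0] i by (auto simp: K_def k0_def simp flip: act_b)
  have "D i m (\<tau> a) = (\<Sum>k\<in>K. \<tau> (\<lambda>i\<in>I. action (M i) (u i) (k i) (a i)))"
    using act_W u a by (auto simp: D_def conformal_at_def u_def K_def tensor_action_def)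
  also have "\<dots> = \<tau> b"
  \<comment> \<open>Tuples with a vanishing factor are excluded from \<open>K\<close>, so
    \<open>K\<close> is empty when the \<open>i\<close>-th mode kills \<open>a i\<close> or some
    other factor of \<open>a\<close> is zero; then \<open>\<tau> b\<close> is zero too.\<close>
  proof (cases "k0 \<in> K")
    case True
    with sub have "K = {k0}" by auto
    then show ?thesis by (simp add: act_b)
  next
    case False
    then obtain j where "j \<in> I" "b j = 0" using k0_iff by auto
    then have "\<tau> b = 0" by (rule multilinear_on_zero[OF multilinear_tau b])
    moreover have "K = {}" using sub False by auto
    ultimately show ?thesis by simp
  qed
  finally show ?thesis by (simp add: b_def)
qed

text \<open>Modes of different factors change different coordinates of a pure tensor and commute;
  modes of one factor satisfy its Virasoro relations. Linearity extends this from pure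
  tensors.\<close>

lemma D_commutator:
  assumes ij: "i \<in> I" "j \<in> I" and w: "w \<in> mspace W"
  shows "D i m (D j n w) - D j n (D i m w) =
    (if i = j then of_int (m - n) *\<^sub>C D i (m + n) w
      + (if m + n = 0 then (of_int (m ^ 3 - m) / 12 * c) *\<^sub>C w else 0) else 0)"
    (is "?f w = ?g w")
proof (rule linear_on_span_eq[of "\<tau> ` pure" ?f ?g])
  have comp: "linear_on (mspace W) (\<lambda>w. D i m (D j n w))" for i j m n
    by (rule linear_on_compose[OF linear_D _ linear_D]) (auto intro: D_closed)
  show "linear_on (cvs.span (\<tau> ` pure)) ?f"
    unfolding W_span[symmetric] by (intro linear_on_lift comp)
  show "linear_on (cvs.span (\<tau> ` pure)) ?g"
    unfolding W_span[symmetric]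
    by (cases "i = j"; cases "m + n = 0")
      (simp_all add: linear_on_lift linear_D linear_on_ident linear_on_const_0)
  show "w \<in> cvs.span (\<tau> ` pure)" using w W_span by simp
next
  fix x assume "x \<in> \<tau> ` pure"
  then obtain a where a: "a \<in> pure" "x = \<tau> a" by auto
  have upd: "a(k := virL V (M k) l (a k)) \<in> pure" if "k \<in> I" for k l
    using that a by (intro PiE_fun_upd) (auto intro: virL_M_closed)
  show "?f x = ?g x"
  proof (cases "i = j")
    case False
    then show ?thesis using ij a by (simp add: D_pure upd fun_upd_twist)
  next
    case True
    define L where "L m = virL V (M i) m" for m
    have ai: "a i \<in> mspace (M i)" and Lc: "\<And>m w. w \<in> mspace (M i) \<Longrightarrow> L m w \<in> mspace (M i)"
      using a ij virL_M_closed by (auto simp: L_def)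
    have lin: "linear_on (mspace (M i)) (\<lambda>y. \<tau> (a(i := y)))"
      by (rule multilinear_onD[OF multilinear_tau a(1) ij(1)])
    have spM: "cvs.subspace (mspace (M i))" by (rule voa_moduleD(1)[OF M[OF ij(1)]])
    have "?f x = \<tau> (a(i := L m (L n (a i)))) - \<tau> (a(i := L n (L m (a i))))"
      using True ij a by (simp add: D_pure upd L_def)
    also have "\<dots> = \<tau> (a(i := L m (L n (a i)) - L n (L m (a i))))"
      using linear_on_diff[OF lin spM Lc[OF Lc[OF ai]] Lc[OF Lc[OF ai]]] by simp
    also have "L m (L n (a i)) - L n (L m (a i)) = of_int (m - n) *\<^sub>C L (m + n) (a i)
      + (if m + n = 0 then (of_int (m ^ 3 - m) / 12 * c) *\<^sub>C a i else 0)"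
      unfolding L_def by (rule virasoro_relationsD[OF voa_moduleD(4)[OF M[OF ij(1)]] ai])
    also have "\<tau> (a(i := \<dots>)) = of_int (m - n) *\<^sub>C \<tau> (a(i := L (m + n) (a i)))
      + (if m + n = 0 then (of_int (m ^ 3 - m) / 12 * c) *\<^sub>C \<tau> (a(i := a i)) else 0)"
      using linear_on_add[OF lin] linear_on_scale[OF lin] linear_on_0[OF lin spM] Lc[OF ai] ai spM
      by (auto simp: cvs.subspace_scale cvs.subspace_add cvs.subspace_0 simp del: fun_upd_triv)
    also have "\<dots> = ?g x"
      using True ij a by (simp add: D_pure L_def)
    finally show ?thesis .
  qed
qed

text \<open>One notation for both the conformal vector of \<open>VV\<close>, with all signs 1, and
  the vectors \<open>\<omega>\<close> attached to codewords, with sign -1 on the codeword.\<close>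

definition signed_conformal :: "('i \<Rightarrow> int) \<Rightarrow> 'b"
  where "signed_conformal s = (\<Sum>i\<in>I. of_int (s i) *\<^sub>C conformal_at I V \<tau>0 i)"

definition LS :: "('i \<Rightarrow> int) \<Rightarrow> int \<Rightarrow> 'c \<Rightarrow> 'c"
  where "LS s m w = action W (signed_conformal s) (m + 1) w"

lemma subspace_VV: "cvs.subspace (mspace VV)"
  using VV by (auto simp: is_voa_def dest: voa_moduleD)

lemma signed_conformal_closed: "signed_conformal s \<in> mspace VV"
  unfolding signed_conformal_def
  by (intro cvs.subspace_sum[OF subspace_VV] cvs.subspace_scale[OF subspace_VV] conformal_at_closed)

lemma LS_eq_sum:
  assumes w: "w \<in> mspace W"
  shows "LS s m w = (\<Sum>i\<in>I. of_int (s i) *\<^sub>C D i m w)"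
proof -
  have lin: "linear_on (mspace VV) (\<lambda>u. action W u (m + 1) w)"
    by (rule vertex_mapD(3)[OF voa_moduleD(2)[OF W] w])
  have "LS s m w = (\<Sum>i\<in>I. action W (of_int (s i) *\<^sub>C conformal_at I V \<tau>0 i) (m + 1) w)"
    unfolding LS_def signed_conformal_def
    by (rule linear_on_sum[OF lin subspace_VV])
      (intro cvs.subspace_scale[OF subspace_VV] conformal_at_closed)
  then show ?thesis by (simp add: linear_on_scale[OF lin] conformal_at_closed D_def)
qed

lemma LS_closed: "w \<in> mspace W \<Longrightarrow> LS s m w \<in> mspace W"
  unfolding LS_def by (rule vertex_mapD(1)[OF voa_moduleD(2)[OF W] signed_conformal_closed])

lemma linear_LS: "linear_on (mspace W) (LS s m)"
  unfolding LS_def by (rule vertex_mapD(2)[OF voa_moduleD(2)[OF W] signed_conformal_closed])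

text \<open>Only the diagonal terms of the double sum survive. They carry the signs
  \<open>s i * t i\<close>, whose sum multiplies the central term.\<close>

lemma LS_commutator:
  assumes w: "w \<in> mspace W"
  shows "LS s m (LS t n w) - LS t n (LS s m w) =
    of_int (m - n) *\<^sub>C LS (\<lambda>i. s i * t i) (m + n) w
      + (if m + n = 0 then (of_int (m ^ 3 - m) / 12 * c * of_int (\<Sum>i\<in>I. s i * t i)) *\<^sub>C w else 0)"
proof -
  have exp: "LS s m (LS t n w) = (\<Sum>i\<in>I. \<Sum>j\<in>I. of_int (s i * t j) *\<^sub>C D i m (D j n w))"
    for s t m n
  proof -
    have cl: "of_int (t j) *\<^sub>C D j n w \<in> mspace W" for j
      using w by (intro cvs.subspace_scale[OF subspace_W] D_closed)
    have "LS s m (LS t n w) = (\<Sum>i\<in>I. of_int (s i) *\<^sub>C D i m (\<Sum>j\<in>I. of_int (t j) *\<^sub>C D j n w))"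
      by (simp add: LS_eq_sum[OF LS_closed[OF w]]) (simp add: LS_eq_sum[OF w])
    also have "\<dots> = (\<Sum>i\<in>I. of_int (s i) *\<^sub>C (\<Sum>j\<in>I. of_int (t j) *\<^sub>C D i m (D j n w)))"
      using w by (simp add: linear_on_sum[OF linear_D subspace_W cl] linear_on_scale[OF linear_D] D_closed)
    finally show ?thesis by (simp add: cvs.scale_sum_right scaleC_scaleC)
  qed
  have "LS t n (LS s m w) = (\<Sum>i\<in>I. \<Sum>j\<in>I. of_int (s i * t j) *\<^sub>C D j n (D i m w))"
    unfolding exp by (subst sum.swap) (simp only: mult.commute)
  then have "LS s m (LS t n w) - LS t n (LS s m w)
    = (\<Sum>i\<in>I. \<Sum>j\<in>I. of_int (s i * t j) *\<^sub>C (D i m (D j n w) - D j n (D i m w)))"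
    by (simp only: exp[of s m t n] sum_subtractf cvs.scale_right_diff_distrib)
  also have "\<dots> = (\<Sum>i\<in>I. \<Sum>j\<in>I. if j = i then of_int (s i * t j) *\<^sub>C (of_int (m - n) *\<^sub>C D i (m + n) w
      + (if m + n = 0 then (of_int (m ^ 3 - m) / 12 * c) *\<^sub>C w else 0)) else 0)"
    by (intro sum.cong refl) (auto simp: D_commutator[OF _ _ w])
  also have "\<dots> = (\<Sum>i\<in>I. of_int (s i * t i) *\<^sub>C (of_int (m - n) *\<^sub>C D i (m + n) w
      + (if m + n = 0 then (of_int (m ^ 3 - m) / 12 * c) *\<^sub>C w else 0)))"
    using finite_I by (intro sum.cong refl) (subst sum.delta, auto)
  also have "\<dots> = of_int (m - n) *\<^sub>C LS (\<lambda>i. s i * t i) (m + n) w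
      + (if m + n = 0 then (of_int (m ^ 3 - m) / 12 * c * of_int (\<Sum>i\<in>I. s i * t i)) *\<^sub>C w else 0)"
    by (auto simp: LS_eq_sum[OF w] scaleC_add_right sum.distrib cvs.scale_sum_right scaleC_scaleC
        cvs.scale_sum_left[symmetric] mult.commute sum_distrib_left sum_distrib_right mult.left_commute)
  finally show ?thesis .
qed

lemma LS_0_pure:
  assumes a: "a \<in> pure" and e: "\<And>i. i \<in> I \<Longrightarrow> virL V (M i) 0 (a i) = e i *\<^sub>C a i"
  shows "LS s 0 (\<tau> a) = (\<Sum>i\<in>I. of_int (s i) * e i) *\<^sub>C \<tau> a"
proof -
  have "D i 0 (\<tau> a) = e i *\<^sub>C \<tau> a" if "i \<in> I" for i
    using that by (simp add: D_pure[OF that a] e multilinear_on_scale[OF multilinear_tau a])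
  then show ?thesis by (simp add: LS_eq_sum tau_closed a cvs.scale_sum_left scaleC_scaleC)
qed

lemma LS_pure_eq_0:
  assumes a: "a \<in> pure" and e: "\<And>i. i \<in> I \<Longrightarrow> virL V (M i) m (a i) = 0"
  shows "LS s m (\<tau> a) = 0"
proof -
  have "D i m (\<tau> a) = 0" if "i \<in> I" for i
  proof -
    have "a(i := 0) \<in> pure"
      using a that by (intro PiE_fun_upd) (auto intro: cvs.subspace_0 voa_moduleD(1)[OF M])
    from multilinear_on_zero[OF multilinear_tau this that] show ?thesis
      using that by (simp add: D_pure[OF that a] e)
  qed
  then show ?thesis by (simp add: LS_eq_sum tau_closed a)
qed

end

text \<open>Since \<open>\<omega> = L(-2)1\<close> and \<open>L(1)\<close> kills the vacuum,
  \<open>L(1)\<omega> = [L(1), L(-2)]1 = 3 L(-1)1 = 0\<close>.\<close>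

lemma voa_modes_of_conformal:
  assumes "is_voa c V"
  shows "virL V V 0 (conformal V) = 2 *\<^sub>C conformal V" "virL V V 1 (conformal V) = 0"
    "virL V V 0 (vacuum V) = 0" "virL V V 1 (vacuum V) = 0"
proof -
  have V: "voa_module c V V" and vac: "vacuum V \<in> mspace V" and om: "conformal V \<in> mspace V"
    using assms by (auto simp: is_voa_def wt_space_def)
  have cr: "action V v (- 1) (vacuum V) = v" "m \<ge> 0 \<Longrightarrow> action V v m (vacuum V) = 0"
    if "v \<in> mspace V" for v m
    using assms that by (auto simp: is_voa_def)
  show "virL V V 0 (conformal V) = 2 *\<^sub>C conformal V"
    using assms by (auto simp: is_voa_def wt_space_def)
  show *: "virL V V 0 (vacuum V) = 0" "virL V V 1 (vacuum V) = 0"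
    using cr om by (auto simp: virL_def)
  have m1: "virL V V (- 1) (vacuum V) = 0" and m2: "virL V V (- 2) (vacuum V) = conformal V"
    using cr om by (auto simp: virL_def)
  have "virL V V (- 2) 0 = 0"
    unfolding virL_def
    by (rule linear_on_0[OF vertex_mapD(2)[OF voa_moduleD(2)[OF V] om] voa_moduleD(1)[OF V]])
  then show "virL V V 1 (conformal V) = 0"
    using virasoro_relationsD[OF voa_moduleD(4)[OF V] vac, of 1 "- 2"] m1 m2 * by simp
qed

text \<open>Each summand is a pure tensor with one conformal vector among vacuum vectors, so its
  weight and its image under \<open>L(1)\<close> can be read off factor by factor. This makes the
  adjoint formula available for all sign vectors.\<close>

lemma signed_conformal_quasi_primary:
  assumes fin: "finite I" and V: "is_voa c V" and tensor: "tensor_voa c I V VV \<tau>0"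
  shows "conformal VV = voa_tensor_product.signed_conformal I V \<tau>0 (\<lambda>_. 1)"
    and "voa_tensor_product.signed_conformal I V \<tau>0 s \<in> wt_space VV VV (of_int 2)"
    and "virL VV VV 1 (voa_tensor_product.signed_conformal I V \<tau>0 s) = 0"
proof -
  interpret voa_tensor_product I c "of_nat (card I) * c" "of_nat (card I) * c" V VV \<tau>0 "\<lambda>_. V" VV \<tau>0
    using assms by unfold_locales (auto simp: tensor_voa_def is_voa_def)
  show conf: "conformal VV = signed_conformal (\<lambda>_. 1)"
    using tensor by (simp add: tensor_voa_def signed_conformal_def)
  have virL: "virL VV VV m w = LS (\<lambda>_. 1) m w" for m w
    by (simp add: virL_def LS_def conf)
  note modes = voa_modes_of_conformal[OF V]
  have pure: "(\<lambda>k\<in>I. if k = j then conformal V else vacuum V) \<in> pure" for j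
    using conformal_V vacuum_V by auto
  have 0: "LS (\<lambda>_. 1) 0 (conformal_at I V \<tau>0 j) = 2 *\<^sub>C conformal_at I V \<tau>0 j" if "j \<in> I" for j
    unfolding conformal_at_def
    using that fin modes
    by (subst LS_0_pure[OF pure, where e = "\<lambda>i. if i = j then 2 else 0"]) auto
  have 1: "LS (\<lambda>_. 1) 1 (conformal_at I V \<tau>0 j) = 0" if "j \<in> I" for j
    unfolding conformal_at_def using modes by (intro LS_pure_eq_0[OF pure]) auto
  have sum: "LS (\<lambda>_. 1) m (signed_conformal s)
    = (\<Sum>j\<in>I. of_int (s j) *\<^sub>C LS (\<lambda>_. 1) m (conformal_at I V \<tau>0 j))" for m
    unfolding signed_conformal_def
    by (simp add: linear_on_sum[OF linear_LS subspace_W] linear_on_scale[OF linear_LS]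
        conformal_at_closed cvs.subspace_scale[OF subspace_W])
  show "signed_conformal s \<in> wt_space VV VV (of_int 2)"
    by (simp add: wt_space_def virL sum 0 signed_conformal_closed)
      (simp add: signed_conformal_def cvs.scale_sum_right scaleC_scaleC mult.commute)
  show "virL VV VV 1 (signed_conformal s) = 0"
    by (simp add: virL sum 1)
qed

section \<open>Lowest weight modules\<close>

text \<open>Words in the negative modes, in arbitrary order, applied to \<open>v\<close>. These
  modes raise the conformal weight, and \<open>k\<close> records the total increase.\<close>

inductive lowering_string :: "(int \<Rightarrow> 'w \<Rightarrow> 'w) \<Rightarrow> 'w \<Rightarrow> nat \<Rightarrow> 'w \<Rightarrow> bool"
  for L v where
    base: "lowering_string L v 0 v"
  | step: "lowering_string L v k w \<Longrightarrow> lowering_string L v (k + Suc n) (L (- int (Suc n)) w)"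

lemma lowering_string_0: "lowering_string L v k w \<Longrightarrow> k = 0 \<Longrightarrow> w = v"
  by (erule lowering_string.cases) auto

lemma lowering_string_weight:
  assumes irr: "irreducible_lowest_weight c h W L v" and "lowering_string L v k w"
  shows "w \<in> W \<and> L 0 w = (h + of_nat k) *\<^sub>C w"
  using assms(2)
proof induction
  case base
  show ?case using irr by (simp add: irreducible_lowest_weight_def)
next
  case (step k w n)
  let ?m = "- int (Suc n)"
  have lin: "linear_on W (L ?m)" and cl: "L ?m w \<in> W" and vir: "virasoro_relations c W L"
    using irr step by (auto simp: irreducible_lowest_weight_def image_subset_iff)
  have "L 0 (L ?m w) = L ?m (L 0 w) + of_int (int (Suc n)) *\<^sub>C L ?m w"
    using virasoro_relationsD[OF vir, of w 0 ?m] step by (simp add: algebra_simps)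
  also have "L ?m (L 0 w) = (h + of_nat k) *\<^sub>C L ?m w"
    unfolding conjunct2[OF step.IH] by (rule linear_on_scale[OF lin conjunct1[OF step.IH]])
  finally show ?case
    using cl by (simp only: scaleC_add_left[symmetric] of_nat_add of_int_of_nat_eq add.assoc simp_thms)
qed

text \<open>By irreducibility it suffices that the span of the strings is stable under all modes.
  Negative modes prolong a string, and any mode can be commuted inwards until it meets
  \<open>v\<close>.\<close>

lemma irreducible_lowest_weight_span:
  assumes irr: "irreducible_lowest_weight c h W L v"
  shows "W = cvs.span {w. \<exists>k. lowering_string L v k w}" (is "W = ?P")
proof -
  have sp: "cvs.subspace W" and lin: "\<And>m. linear_on W (L m)" and cl: "\<And>m w. w \<in> W \<Longrightarrow> L m w \<in> W"
    and vir: "virasoro_relations c W L" and v: "v \<in> W" "v \<noteq> 0" "L 0 v = h *\<^sub>C v" "\<And>m. m > 0 \<Longrightarrow> L m v = 0"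
    and simple: "\<And>U. cvs.subspace U \<Longrightarrow> U \<subseteq> W \<Longrightarrow> \<forall>m. L m ` U \<subseteq> U \<Longrightarrow> U = {0} \<or> U = W"
    using irr by (auto simp: irreducible_lowest_weight_def image_subset_iff)
  have PW: "?P \<subseteq> W"
    using lowering_string_weight[OF irr] by (intro cvs.span_minimal[OF _ sp]) auto
  have invar: "L m x \<in> ?P" if gen: "\<And>w k. lowering_string L v k w \<Longrightarrow> L m w \<in> ?P" and x: "x \<in> ?P" for m x
  proof -
    have "x \<in> ?P \<and> L m x \<in> ?P"
      using x
    proof (induction rule: cvs.span_induct_alt)
      case base
      show ?case by (simp add: linear_on_0[OF lin sp] cvs.span_zero)
    next
      case (step a y z)
      then have y: "y \<in> ?P" by (simp add: cvs.span_base)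
      then have "y \<in> W" "z \<in> W" using step PW by auto
      then have "L m (a *\<^sub>C y + z) = a *\<^sub>C L m y + L m z"
        by (simp add: linear_on_add[OF lin] linear_on_scale[OF lin] cvs.subspace_scale[OF sp])
      then show ?case using step gen y by (auto intro!: cvs.span_add cvs.span_scale)
    qed
    then show ?thesis ..
  qed
  have neg: "L (- int (Suc n)) x \<in> ?P" if "x \<in> ?P" for n x
    by (intro invar[OF _ that] cvs.span_base CollectI exI) (rule lowering_string.step)
  have string: "L m w \<in> ?P" if "lowering_string L v k w" for m k w
    using that
  proof (induction arbitrary: m)
    case base
    have vP: "v \<in> ?P" by (auto intro: cvs.span_base lowering_string.base)
    consider "m > 0" | "m = 0" | n where "m = - int (Suc n)"
      by (metis linorder_neqE_linordered_idom negD)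
    then show ?case
      using vP v neg[OF vP] by cases (auto simp: cvs.span_zero intro: cvs.span_scale)
  next
    case (step k w n)
    let ?m = "- int (Suc n)"
    have "w \<in> W" using lowering_string_weight[OF irr step.hyps] by simp
    \<comment> \<open>Each term on the right applies a mode to the shorter string \<open>w\<close>,
      or is a multiple of \<open>w\<close>.\<close>
    then have "L m (L ?m w) = (of_int (m - ?m) *\<^sub>C L (m + ?m) w
      + (if m + ?m = 0 then (of_int (m ^ 3 - m) / 12 * c) *\<^sub>C w else 0)) + L ?m (L m w)"
      by (intro virasoro_relationsD[OF vir, THEN diff_eq_eq[THEN iffD1]])
    also have "\<dots> \<in> ?P"
      using step by (intro cvs.span_add neg cvs.span_scale)
        (auto simp: cvs.span_zero intro: cvs.span_scale cvs.span_base)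
    finally show ?case .
  qed
  then have "\<forall>m. L m ` ?P \<subseteq> ?P" using invar by blast
  then have "?P = {0} \<or> ?P = W"
    by (rule simple[OF cvs.subspace_span PW])
  moreover have "v \<in> ?P" by (auto intro: cvs.span_base lowering_string.base)
  ultimately show ?thesis using v by auto
qed

section \<open>Strings of Virasoro modes\<close>

lemma Ints_diff_trans:
  "a - b \<in> \<int> \<Longrightarrow> b - c \<in> \<int> \<Longrightarrow> (a - c :: 'a::ring_1) \<in> \<int>"
  by (drule (1) Ints_add) simp

text \<open>Modulo \<open>\<int>\<close> the modes of a string may be permuted, since commutators lead to shorter strings. A
  positive mode is moved next to \<open>S b\<close>, turned into a zero mode there, and moved back to the front,
  where \<open>\<phi>\<close> turns it into an integer factor.\<close>

lemma mode_string_integral: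
  fixes X :: "'t \<Rightarrow> int \<Rightarrow> 'w \<Rightarrow> 'w::complex_vector" and S :: "complex \<Rightarrow> 'w" and \<phi> :: "'w \<Rightarrow> complex"
  assumes closed: "\<And>t m w. t \<in> T \<Longrightarrow> w \<in> E \<Longrightarrow> X t m w \<in> E"
    and sp: "cvs.subspace E"
    and lin: "\<And>t m. t \<in> T \<Longrightarrow> linear_on E (X t m)"
    and mul: "\<And>s t. s \<in> T \<Longrightarrow> t \<in> T \<Longrightarrow> mul s t \<in> T"
    and comm: "\<And>s t m n w. s \<in> T \<Longrightarrow> t \<in> T \<Longrightarrow> w \<in> E \<Longrightarrow> \<exists>d\<in>\<int>. X s m (X t n w) - X t n (X s m w)
      = of_int (m - n) *\<^sub>C X (mul s t) (m + n) w + d *\<^sub>C w"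
    and S: "\<And>b. S b \<in> E"
    and reduce: "\<And>t m b. t \<in> T \<Longrightarrow> m > 0 \<Longrightarrow>
      \<exists>e\<in>\<int>. X t m (S b) = X t 0 (S (b + of_int m)) + e *\<^sub>C S (b + of_int m)"
    and \<phi>: "linear_on E \<phi>"
    and neg: "\<And>t m w. t \<in> T \<Longrightarrow> m < 0 \<Longrightarrow> w \<in> E \<Longrightarrow> \<phi> (X t m w) = 0"
    and zero: "\<And>t. t \<in> T \<Longrightarrow> \<exists>h\<in>\<int>. \<forall>w\<in>E. \<phi> (X t 0 w) = h * \<phi> w"
    and int: "\<And>b. \<phi> (S b) \<in> \<int>"
    and xs: "fst ` set xs \<subseteq> T"
  shows "\<phi> (foldr (\<lambda>(t, m). X t m) xs (S b)) \<in> \<int>"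
proof -
  define st where "st xs w = foldr (\<lambda>(t, m). X t m) xs w" for xs w
  have st_simps [simp]: "st [] w = w" "st ((t, m) # ys) w = X t m (st ys w)"
    "st (ys @ zs) w = st ys (st zs w)" for t m ys zs w
    by (simp_all add: st_def)
  have st: "st ys w \<in> E" if "fst ` set ys \<subseteq> T" "w \<in> E" for ys w
    using that by (induction ys) (auto intro: closed)
  have lin_st: "linear_on E (st ys)" if "fst ` set ys \<subseteq> T" for ys
    using that
  proof (induction ys)
    case Nil
    show ?case using linear_on_ident by (simp add: linear_on_def)
  next
    case (Cons y ys)
    obtain t m where y: "y = (t, m)" by force
    have "linear_on E (\<lambda>w. X t m (st ys w))"
      using Cons y by (intro linear_on_compose[OF _ _ lin]) (auto intro: st)
    then show ?case by (simp add: y linear_on_def)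
  qed
  have "\<phi> (st xs (S b)) \<in> \<int>"
    using xs
  \<comment> \<open>The index \<open>b\<close> must vary because replacing a positive mode by a zero
    mode shifts it.\<close>
  proof (induction "length xs" arbitrary: xs b rule: less_induct)
    case less
    \<comment> \<open>The commutator merges two modes into one or removes both, so the difference is
      an integral combination of values of shorter strings.\<close>
    have swap: "\<phi> (st (pre @ (s, m) # (t, k) # zs) (S b)) - \<phi> (st (pre @ (t, k) # (s, m) # zs) (S b)) \<in> \<int>"
      if T: "fst ` set pre \<subseteq> T" "fst ` set zs \<subseteq> T" "s \<in> T" "t \<in> T"
        and len: "length pre + length zs + 2 = length xs" for pre zs s t m k b
    proof -
      let ?z = "st zs (S b)"
      have z: "?z \<in> E" using T S by (intro st)
      obtain d where d: "d \<in> \<int>" "X s m (X t k ?z) - X t k (X s m ?z)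
          = of_int (m - k) *\<^sub>C X (mul s t) (m + k) ?z + d *\<^sub>C ?z"
        using comm[OF T(3,4) z] by blast
      have pre: "linear_on E (\<lambda>w. \<phi> (st pre w))"
        using T by (intro linear_on_compose[OF lin_st _ \<phi>]) (auto intro: st)
      have "\<phi> (st pre (X s m (X t k ?z))) - \<phi> (st pre (X t k (X s m ?z)))
        = \<phi> (st pre (of_int (m - k) *\<^sub>C X (mul s t) (m + k) ?z + d *\<^sub>C ?z))"
        using linear_on_diff[OF pre sp, of "X s m (X t k ?z)" "X t k (X s m ?z)"] d(2) z T
        by (simp add: closed)
      also have "\<dots> = of_int (m - k) * \<phi> (st (pre @ (mul s t, m + k) # zs) (S b)) + d * \<phi> (st (pre @ zs) (S b))"
        using z T mul
        by (simp add: linear_on_add[OF pre] linear_on_scale[OF pre] closed cvs.subspace_scale[OF sp] scaleC_complex_def)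
      also have "\<dots> \<in> \<int>"
        using T len mul d(1) by (intro Ints_add Ints_mult less.hyps) auto
      finally show ?thesis by simp
    qed
    have move: "\<phi> (st (pre @ (s, m) # ys @ zs) (S b)) - \<phi> (st (pre @ ys @ (s, m) # zs) (S b)) \<in> \<int>"
      if "fst ` set pre \<subseteq> T" "fst ` set ys \<subseteq> T" "fst ` set zs \<subseteq> T" "s \<in> T"
        "length pre + length ys + length zs + 1 = length xs" for pre ys zs s m b
      using that
    proof (induction ys arbitrary: pre)
      case Nil
      show ?case by simp
    next
      case (Cons y ys)
      obtain t k where y: "y = (t, k)" by force
      have "\<phi> (st (pre @ (s, m) # (t, k) # (ys @ zs)) (S b)) - \<phi> (st (pre @ (t, k) # (s, m) # (ys @ zs)) (S b)) \<in> \<int>"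
        using Cons.prems y by (intro swap) auto
      moreover have "\<phi> (st ((pre @ [(t, k)]) @ (s, m) # ys @ zs) (S b))
          - \<phi> (st ((pre @ [(t, k)]) @ ys @ (s, m) # zs) (S b)) \<in> \<int>"
        using Cons.prems y by (intro Cons.IH) auto
      ultimately show ?case by (simp add: y) (erule (1) Ints_diff_trans)
    qed
    have zero_mode: "\<phi> (st ((t, 0) # ys) (S b)) \<in> \<int>"
      if t: "t \<in> T" and ys: "fst ` set ys \<subseteq> T" "length ys < length xs" for t ys b
    proof -
      obtain h where h: "h \<in> \<int>" "\<And>w. w \<in> E \<Longrightarrow> \<phi> (X t 0 w) = h * \<phi> w" using zero[OF t] by blast
      then have "\<phi> (st ((t, 0) # ys) (S b)) = h * \<phi> (st ys (S b))"
        using st[OF ys(1) S] by simp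
      also have "\<dots> \<in> \<int>" using h less.hyps ys by (intro Ints_mult) auto
      finally show ?thesis .
    qed
    show ?case
    proof (cases xs)
      case Nil
      then show ?thesis using int by simp
    next
      case (Cons x ys)
      obtain t m where x: "x = (t, m)" by force
      have t: "t \<in> T" and ys: "fst ` set ys \<subseteq> T" using less.prems Cons x by auto
      consider "m < 0" | "m = 0" | "m > 0" by linarith
      then show ?thesis
      proof cases
        case 1
        then show ?thesis using neg[OF t 1 st[OF ys S]] Cons x by simp
      next
        case 2
        then show ?thesis using zero_mode[OF t ys] Cons x by simp
      next
        case 3
        obtain e where e: "e \<in> \<int>" "X t m (S b) = X t 0 (S (b + of_int m)) + e *\<^sub>C S (b + of_int m)"
          using reduce[OF t 3] by blast
        let ?b = "b + of_int m"
        have ly: "linear_on E (\<lambda>w. \<phi> (st ys w))"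
          using ys by (intro linear_on_compose[OF lin_st _ \<phi>]) (auto intro: st)
        have end_of_string: "\<phi> (st (ys @ [(t, m)]) (S b)) = \<phi> (st (ys @ [(t, 0)]) (S ?b)) + e * \<phi> (st ys (S ?b))"
          by (simp add: e(2) linear_on_add[OF ly] linear_on_scale[OF ly] closed t S
              cvs.subspace_scale[OF sp] scaleC_complex_def)
        have 1: "\<phi> (st ((t, m) # ys) (S b)) - \<phi> (st (ys @ [(t, m)]) (S b)) \<in> \<int>"
          using move[of "[]" ys "[]" t m b] t ys Cons by simp
        have 2: "\<phi> (st ((t, 0) # ys) (S ?b)) - \<phi> (st (ys @ [(t, 0)]) (S ?b)) \<in> \<int>"
          using move[of "[]" ys "[]" t 0 ?b] t ys Cons by simp
        have 3: "\<phi> (st ((t, 0) # ys) (S ?b)) \<in> \<int>"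
          using t ys Cons by (intro zero_mode) auto
        have 4: "e * \<phi> (st ys (S ?b)) \<in> \<int>"
          using e ys Cons by (intro Ints_mult less.hyps) auto
        \<comment> \<open>By \<open>end_of_string\<close> this expression telescopes to the value of
          the original string.\<close>
        have "(\<phi> (st ((t, m) # ys) (S b)) - \<phi> (st (ys @ [(t, m)]) (S b)))
          - (\<phi> (st ((t, 0) # ys) (S ?b)) - \<phi> (st (ys @ [(t, 0)]) (S ?b)))
          + \<phi> (st ((t, 0) # ys) (S ?b)) + e * \<phi> (st ys (S ?b)) \<in> \<int>"
          by (rule Ints_add[OF Ints_add[OF Ints_diff[OF 1 2] 3] 4])
        then have "\<phi> (st ((t, m) # ys) (S b)) \<in> \<int>"
          unfolding end_of_string by (simp only: algebra_simps) simp
        then show ?thesis using Cons x by simp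
      qed
    qed
  qed
  then show ?thesis by (simp add: st_def)
qed

text \<open>Only \<open>i = 0\<close> and \<open>i = 1\<close> contribute to the commutator formula.
  For \<open>u\<close> of conformal type these terms involve \<open>L(-1)w1\<close> and the weight
  of \<open>w1\<close>.\<close>

lemma vertex_map_primary_commutator:
  assumes Y: "vertex_map V W1 W2 W3 Y" and W1: "voa_module c V W1" and u: "u \<in> mspace V"
    and w: "w1 \<in> mspace W1" "w2 \<in> mspace W2"
    and one: "action W1 u 1 w1 = h *\<^sub>C w1" and high: "\<And>i. i \<ge> 2 \<Longrightarrow> action W1 u i w1 = 0"
  shows "action W3 u m (Y w1 b w2) = Y w1 b (action W2 u m w2)
    + Y (action W1 u 0 w1) (of_int m + b) w2 + (of_int m * h) *\<^sub>C Y w1 (of_int m + b - 1) w2"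
proof -
  define g where "g i = ((of_int m :: complex) gchoose i) *\<^sub>C
          Y (action W1 u (int i) w1) (of_int m + b - of_nat i) w2" for i
  note lin = vertex_mapD(3)[OF Y w(2)]
  have "g i = 0" if "i \<notin> {0, 1}" for i
    using that high[of "int i"] linear_on_0[OF lin voa_moduleD(1)[OF W1]] by (auto simp: g_def)
  then have "Sum_any g = g 0 + g 1"
    by (subst Sum_any.expand_superset[of "{0, 1}"]) auto
  also have "g 1 = (of_int m * h) *\<^sub>C Y w1 (of_int m + b - 1) w2"
    by (simp add: g_def one linear_on_scale[OF lin w(1)] scaleC_scaleC)
  finally show ?thesis
    using vertex_map_commutator[OF Y u w, of m b] by (simp add: g_def[abs_def] algebra_simps)
qed

section \<open>Tensor products of modules for the Ising vertex operator algebra\<close>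

declare One_nat_def [simp del]

definition code_sign :: "'i set \<Rightarrow> 'i \<Rightarrow> int"
  where "code_sign T i = (if i \<in> T then -1 else 1)"

text \<open>Signs turn symmetric differences into products; this is why commutators of code modes
  stay among code modes.\<close>

lemma code_sign_mult:
  "(\<lambda>i. code_sign S i * code_sign T i) = code_sign ((S - T) \<union> (T - S))"
  by (auto simp: code_sign_def)

lemma sum_code_sign:
  assumes "finite I" "T \<subseteq> I"
  shows "(\<Sum>i\<in>I. code_sign T i) = int (card I) - 2 * int (card T)"
proof -
  have "(\<Sum>i\<in>I. code_sign T i) = (\<Sum>i\<in>T. code_sign T i) + (\<Sum>i\<in>I - T. code_sign T i)"
    using assms by (metis add.commute sum.subset_diff)
  also have "\<dots> = - int (card T) + int (card (I - T))"
    by (simp add: code_sign_def)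
  finally show ?thesis
    using assms finite_subset[OF assms(2,1)] by (simp add: card_Diff_subset of_nat_diff card_mono)
qed

text \<open>For \<open>k = 4 * j\<close> the term equals \<open>j\<close> times the binomial
  coefficient of \<open>m + 1\<close> over 3.\<close>

lemma virasoro_central_term_Ints:
  assumes "4 dvd k"
  shows "(of_int (m ^ 3 - m) / 12 * (1/2) * of_int k :: complex) \<in> \<int>"
proof -
  obtain j where j: "k = 4 * j" using assms by auto
  have "of_int (m ^ 3 - m) / 12 * (1/2) * of_int k = ((of_int (m + 1) :: complex) gchoose 3) * of_int j"
    by (simp add: j gbinomial_prod_rev numeral_3_eq_3 fact_numeral field_simps power3_eq_cube)
  also have "\<dots> \<in> \<int>" by (intro Ints_mult gbinomial_Ints Ints_of_int)
  finally show ?thesis .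
qed

locale ising_tensor_module =
  fixes n :: nat and V :: "'a::complex_vector voa" and L :: "complex \<Rightarrow> ('a, 'a) vmodule"
    and v :: "complex \<Rightarrow> 'a" and f :: "complex \<Rightarrow> 'a \<Rightarrow> 'a \<Rightarrow> complex"
    and VV :: "'b::complex_vector voa" and \<tau>0 :: "(nat \<Rightarrow> 'a) \<Rightarrow> 'b"
    and W :: "(nat \<Rightarrow> complex) \<Rightarrow> ('b, 'c::complex_vector) vmodule"
    and \<tau> :: "(nat \<Rightarrow> complex) \<Rightarrow> (nat \<Rightarrow> 'a) \<Rightarrow> 'c"
    and F :: "(nat \<Rightarrow> complex) \<Rightarrow> 'c \<Rightarrow> 'c \<Rightarrow> complex"
    and H :: "nat \<Rightarrow> complex"
  assumes ising: "ising_modules V L v f"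
    and tensor: "ising_tensor_modules n V L f VV \<tau>0 W \<tau> F"
    and H: "H \<in> {1..n} \<rightarrow>\<^sub>E ising_weights"
begin

lemma H_weights: "i \<in> {1..n} \<Longrightarrow> H i \<in> ising_weights"
  using H by auto

sublocale voa_tensor_product "{1..n}" "1/2" "of_nat (card {1..n}) * (1/2)" "of_nat (card {1..n}) * (1/2)"
    V VV \<tau>0 "\<lambda>i. L (H i)" "W H" "\<tau> H"
proof
  show "is_voa (1/2) V" "\<And>i. i \<in> {1..n} \<Longrightarrow> voa_module (1/2) V (L (H i))"
    using ising H_weights by (auto simp: ising_modules_def)
qed (use tensor H in \<open>auto simp: ising_tensor_modules_def tensor_voa_def tensor_module_def\<close>)

abbreviation vH :: 'c
  where "vH \<equiv> lowest_vector n v \<tau> H"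

abbreviation FH :: "'c \<Rightarrow> 'c \<Rightarrow> complex"
  where "FH \<equiv> F H"

lemma form:
  shows invariant_F: "invariant_form VV (W H) FH" and nondegenerate_F: "nondegenerate_on (mspace (W H)) FH"
    and F_pure: "\<And>a b. a \<in> pure \<Longrightarrow> b \<in> pure \<Longrightarrow> FH (\<tau> H a) (\<tau> H b) = (\<Prod>i\<in>{1..n}. f (H i) (a i) (b i))"
  using tensor H by (auto simp: ising_tensor_modules_def tensor_form_def)

lemma factor:
  assumes "i \<in> {1..n}"
  shows "irreducible_lowest_weight (1/2) (H i) (mspace (L (H i))) (virL V (L (H i))) (v (H i))"
    and "f (H i) (v (H i)) (v (H i)) = 1"
  using ising H_weights[OF assms] by (auto simp: ising_modules_def)

lemma lowest_pure: "(\<lambda>i\<in>{1..n}. v (H i)) \<in> pure"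
  using factor by (auto simp: irreducible_lowest_weight_def)

lemma vH_closed: "vH \<in> mspace (W H)"
  unfolding lowest_vector_def by (rule tau_closed[OF lowest_pure])

lemma LS_vH:
  shows "LS s 0 vH = (\<Sum>i\<in>{1..n}. of_int (s i) * H i) *\<^sub>C vH" and "m > 0 \<Longrightarrow> LS s m vH = 0"
proof -
  have *: "virL V (L (H i)) 0 (v (H i)) = H i *\<^sub>C v (H i)" "m > 0 \<Longrightarrow> virL V (L (H i)) m (v (H i)) = 0"
    if "i \<in> {1..n}" for i
    using factor(1)[OF that] by (auto simp: irreducible_lowest_weight_def)
  show "LS s 0 vH = (\<Sum>i\<in>{1..n}. of_int (s i) * H i) *\<^sub>C vH"
    unfolding lowest_vector_def using * by (intro LS_0_pure lowest_pure) simp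
  show "m > 0 \<Longrightarrow> LS s m vH = 0"
    unfolding lowest_vector_def using * by (intro LS_pure_eq_0 lowest_pure) simp
qed

lemma F_vH: "FH vH vH = 1"
  unfolding lowest_vector_def by (simp add: F_pure[OF lowest_pure lowest_pure] factor(2) del: prod_eq_1_iff)

lemma vH_nonzero: "vH \<noteq> 0"
proof
  assume "vH = 0"
  moreover have "FH vH 0 = 0"
    using invariant_F vH_closed
    by (intro linear_on_0[OF _ subspace_W]) (auto simp: invariant_form_def bilinear_on_def)
  ultimately show False using F_vH by simp
qed

lemma linear_F:
  "w \<in> mspace (W H) \<Longrightarrow> linear_on (mspace (W H)) (FH w)"
  "w \<in> mspace (W H) \<Longrightarrow> linear_on (mspace (W H)) (\<lambda>x. FH x w)"
  using invariant_F by (auto simp: invariant_form_def bilinear_on_def)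

lemma signed_quasi_primary:
  shows conformal_eq: "conformal VV = signed_conformal (\<lambda>_. 1)"
    and "signed_conformal s \<in> wt_space VV VV (of_int 2)"
    and "virL VV VV 1 (signed_conformal s) = 0"
  using signed_conformal_quasi_primary[OF finite_I V] tensor
  by (auto simp: ising_tensor_modules_def)

text \<open>For weight 2 the sign is 1 and mode \<open>m + 1\<close> goes to
  \<open>4 - (m + 1) - 2 = -m + 1\<close>.\<close>

lemma F_adjoint:
  assumes "w' \<in> mspace (W H)" "w \<in> mspace (W H)"
  shows "FH (LS s m w') w = FH w' (LS s (- m) w)"
  using invariant_form_quasi_primary[OF invariant_F VV W signed_quasi_primary(2,3) assms, of s "m + 1"]
  by (simp add: LS_def)

lemma wt_space_iff: "w \<in> wt_space VV (W H) h \<longleftrightarrow> w \<in> mspace (W H) \<and> LS (\<lambda>_. 1) 0 w = h *\<^sub>C w"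
  by (simp add: wt_space_def virL_def LS_def conformal_eq)

text \<open>\<open>L(0)\<close> is self-adjoint for the form.\<close>

lemma weight_orthogonal:
  assumes w: "w \<in> wt_space VV (W H) h" "w' \<in> wt_space VV (W H) h'" and "h \<noteq> h'"
  shows "FH w w' = 0"
proof -
  have m: "w \<in> mspace (W H)" "w' \<in> mspace (W H)" using w by (auto simp: wt_space_def)
  have "h * FH w w' = FH (LS (\<lambda>_. 1) 0 w) w'"
    using w m linear_on_scale[OF linear_F(2)[OF m(2)] m(1)] by (simp add: wt_space_iff scaleC_complex_def)
  also have "\<dots> = FH w (LS (\<lambda>_. 1) 0 w')" using F_adjoint[OF m] by simp
  also have "\<dots> = h' * FH w w'"
    using w m linear_on_scale[OF linear_F(1)[OF m(1)] m(2)] by (simp add: wt_space_iff scaleC_complex_def)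
  finally show ?thesis using \<open>h \<noteq> h'\<close> by simp
qed

lemma vH_weight: "vH \<in> wt_space VV (W H) (\<Sum>i\<in>{1..n}. H i)"
  by (simp add: wt_space_iff vH_closed LS_vH)

text \<open>The module is spanned by \<open>vH\<close> and vectors of higher weight, and the latter are orthogonal to the
  lowest weight space.\<close>

lemma lowest_weight_space:
  assumes w: "w \<in> wt_space VV (W H) (\<Sum>i\<in>{1..n}. H i)"
  shows "w = FH w vH *\<^sub>C vH"
proof -
  let ?h = "\<Sum>i\<in>{1..n}. H i"
  \<comment> \<open>\<open>x\<close> is the part of \<open>w\<close> orthogonal to
    \<open>vH\<close>; it is shown to be orthogonal to everything, so that nondegeneracy gives
    \<open>x = 0\<close>.\<close>
  define x where "x = w - FH w vH *\<^sub>C vH"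
  have wm: "w \<in> mspace (W H)" using w by (simp add: wt_space_def)
  have c: "FH w vH *\<^sub>C vH \<in> mspace (W H)" by (intro cvs.subspace_scale[OF subspace_W] vH_closed)
  have xm: "x \<in> mspace (W H)"
    unfolding x_def by (intro cvs.subspace_diff[OF subspace_W] wm c)
  have "LS (\<lambda>_. 1) 0 x = ?h *\<^sub>C x"
    using w vH_weight
    by (simp add: x_def linear_on_diff[OF linear_LS subspace_W wm c] linear_on_scale[OF linear_LS vH_closed]
        wt_space_iff cvs.scale_right_diff_distrib scaleC_scaleC mult.commute)
  then have x: "x \<in> wt_space VV (W H) ?h" using xm by (simp add: wt_space_iff)
  have xv: "FH x vH = 0"
    unfolding x_def
    by (simp add: linear_on_diff[OF linear_F(2)[OF vH_closed] subspace_W wm c]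
        linear_on_scale[OF linear_F(2)[OF vH_closed] vH_closed] F_vH scaleC_complex_def)
  define E where "E i = {y. \<exists>k. lowering_string (virL V (L (H i))) (v (H i)) k y}" for i
  have span_E: "mspace (L (H i)) = cvs.span (E i)" if "i \<in> {1..n}" for i
    unfolding E_def by (rule irreducible_lowest_weight_span[OF factor(1)[OF that]])
  have PE: "Pi\<^sub>E {1..n} (\<lambda>i. cvs.span (E i)) = pure"
    using span_E by (intro PiE_cong) auto
  have multi: "multilinear_on {1..n} (\<lambda>i. cvs.span (E i)) (\<lambda>a. FH x (\<tau> H a))"
    unfolding multilinear_on_def PE
  proof (intro ballI)
    fix a i assume a: "a \<in> pure" "i \<in> {1..n}"
    show "linear_on (cvs.span (E i)) (\<lambda>y. FH x (\<tau> H (a(i := y))))"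
      using a unfolding span_E[OF a(2), symmetric]
      by (intro linear_on_compose[OF multilinear_onD[OF multilinear_tau a] _ linear_F(1)[OF xm]])
        (auto intro!: tau_closed PiE_fun_upd)
  qed
  have "FH x (\<tau> H a) = 0" if a: "a \<in> Pi\<^sub>E {1..n} E" for a
  proof -
    have "\<forall>i\<in>{1..n}. \<exists>k. lowering_string (virL V (L (H i))) (v (H i)) k (a i)"
      using a by (auto simp: E_def)
    then obtain k where k: "\<And>i. i \<in> {1..n} \<Longrightarrow> lowering_string (virL V (L (H i))) (v (H i)) (k i) (a i)"
      by metis
    have ap: "a \<in> pure" unfolding PE[symmetric] using a by (auto intro: cvs.span_base)
    have "LS (\<lambda>_. 1) 0 (\<tau> H a) = (\<Sum>i\<in>{1..n}. of_int 1 * (H i + of_nat (k i))) *\<^sub>C \<tau> H a"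
      using lowering_string_weight[OF factor(1) k] by (intro LS_0_pure ap) auto
    then have wt: "\<tau> H a \<in> wt_space VV (W H) (?h + of_nat (\<Sum>i\<in>{1..n}. k i))"
      by (simp add: wt_space_iff tau_closed ap sum.distrib)
    show ?thesis
    \<comment> \<open>If the total weight increase is zero, all strings are empty and the tensor is
      \<open>vH\<close>; otherwise it has a weight different from that of \<open>x\<close>.\<close>
    proof (cases "(\<Sum>i\<in>{1..n}. k i) = 0")
      case True
      then have "a i = v (H i)" if "i \<in> {1..n}" for i
        using lowering_string_0[OF k[OF that]] that by simp
      then have "a = (\<lambda>i\<in>{1..n}. v (H i))"
        using a by (auto simp: PiE_iff extensional_def)
      then show ?thesis using xv by (simp add: lowest_vector_def)
    next
      case False
      then have "?h \<noteq> ?h + of_nat (\<Sum>i\<in>{1..n}. k i)"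
        by (simp only: add_cancel_right_right of_nat_eq_0_iff not_False_eq_True)
      then show ?thesis by (rule weight_orthogonal[OF x wt])
    qed
  qed
  then have pure0: "FH x (\<tau> H a) = 0" if "a \<in> pure" for a
    using multilinear_on_eq_0[OF finite_I multi] that by (auto simp: PE)
  have "FH x u = 0" if "u \<in> mspace (W H)" for u
    using linear_on_span_eq[of "\<tau> H ` pure" "FH x" "\<lambda>_. 0" u] linear_F(1)[OF xm] pure0 that
      linear_on_const_0 by (auto simp flip: W_span)
  then have "x = 0" using nondegenerate_F xm by (auto simp: nondegenerate_on_def)
  then show ?thesis by (simp add: x_def)
qed

lemma code_conformal_eq:
  assumes "T \<subseteq> {1..n}"
  shows "code_conformal n V \<tau>0 T = signed_conformal (code_sign T)"
proof -
  have "signed_conformal (code_sign T) = (\<Sum>i\<in>{1..n} - T. conformal_at {1..n} V \<tau>0 i)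
      + (\<Sum>i\<in>T. - conformal_at {1..n} V \<tau>0 i)"
    unfolding signed_conformal_def
    by (subst sum.subset_diff[OF assms]) (auto simp: code_sign_def intro!: arg_cong2[where f = "(+)"] sum.cong)
  then show ?thesis by (simp add: code_conformal_def sum_negf)
qed

text \<open>The zero mode preserves \<open>M\<close>, so all powers of its rational eigenvalue carry
  \<open>vH\<close> into the integral form, which forces the eigenvalue to be an integer.\<close>

lemma code_weight_Ints:
  assumes form: "module_integral_form VV A (W H) M" and u: "signed_conformal s \<in> A" and v: "vH \<in> M"
  shows "(\<Sum>i\<in>{1..n}. of_int (s i) * H i) \<in> \<int>" (is "?q \<in> _")
proof (rule integral_form_eigenvalue_Ints[OF form v vH_nonzero])
  have "H i \<in> \<rat>" if "i \<in> {1..n}" for i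
    using H_weights[OF that] unfolding ising_weights_def insert_iff empty_iff simp_thms
    by (elim disjE) (simp_all only: Rats_0 Rats_1 Rats_divide Rats_number_of)
  then show "?q \<in> \<rat>" by (intro Rats_sum Rats_mult) auto
  show "?q ^ k *\<^sub>C vH \<in> M" for k
  proof (induction k)
    case 0
    show ?case using v by simp
  next
    case (Suc k)
    have "LS s 0 (?q ^ k *\<^sub>C vH) \<in> M"
      unfolding LS_def using form Suc u by (auto simp: module_integral_form_def subring_module_def)
    then show ?case
      by (simp add: linear_on_scale[OF linear_LS vH_closed] LS_vH scaleC_scaleC mult.commute)
  qed
qed

text \<open>The signs sum to \<open>n\<close> minus twice the size of the symmetric difference. This
  is divisible by 4, so the central term is integral.\<close>

lemma LS_code_commutator:
  assumes n: "4 dvd n" and C: "binary_linear_code {1..n} C" "C \<subseteq> even_code {1..n}"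
    and ST: "S \<in> C" "T \<in> C" and w: "w \<in> mspace (W H)"
  shows "\<exists>d\<in>\<int>. LS (code_sign S) m (LS (code_sign T) k w) - LS (code_sign T) k (LS (code_sign S) m w)
    = of_int (m - k) *\<^sub>C LS (code_sign ((S - T) \<union> (T - S))) (m + k) w + d *\<^sub>C w"
proof -
  let ?R = "(S - T) \<union> (T - S)"
  have "?R \<in> C" using C(1) ST by (auto simp: binary_linear_code_def)
  then have R: "?R \<subseteq> {1..n}" "even (card ?R)" using C(2) by (auto simp: even_code_def)
  have "(\<Sum>i\<in>{1..n}. code_sign S i * code_sign T i) = int n - 2 * int (card ?R)"
    using sum_code_sign[OF finite_I R(1)] fun_cong[OF code_sign_mult[of S T]] by simp
  moreover have "4 dvd int n - 2 * int (card ?R)"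
    using n R(2) by (intro dvd_diff) auto
  ultimately have dvd: "4 dvd (\<Sum>i\<in>{1..n}. code_sign S i * code_sign T i)" by simp
  define d where "d = (if m + k = 0 then of_int (m ^ 3 - m) / 12 * (1/2)
      * of_int (\<Sum>i\<in>{1..n}. code_sign S i * code_sign T i) else (0::complex))"
  have "d \<in> \<int>" using virasoro_central_term_Ints[OF dvd] by (simp add: d_def)
  moreover have "LS (code_sign S) m (LS (code_sign T) k w) - LS (code_sign T) k (LS (code_sign S) m w)
    = of_int (m - k) *\<^sub>C LS (code_sign ?R) (m + k) w + d *\<^sub>C w"
    unfolding LS_commutator[OF w] code_sign_mult d_def by auto
  ultimately show ?thesis by blast
qed

end

theorem theorem7p2:
  fixes n :: nat
    and C :: "nat set set"
    and V :: "'a::complex_vector voa"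
    and L :: "complex \<Rightarrow> ('a, 'a) vmodule"
    and v :: "complex \<Rightarrow> 'a"
    and f :: "complex \<Rightarrow> 'a \<Rightarrow> 'a \<Rightarrow> complex"
    and VV :: "'b::complex_vector voa"
    and \<tau>0 :: "(nat \<Rightarrow> 'a) \<Rightarrow> 'b"
    and W :: "(nat \<Rightarrow> complex) \<Rightarrow> ('b, 'c::complex_vector) vmodule"
    and \<tau> :: "(nat \<Rightarrow> complex) \<Rightarrow> (nat \<Rightarrow> 'a) \<Rightarrow> 'c"
    and F :: "(nat \<Rightarrow> complex) \<Rightarrow> 'c \<Rightarrow> 'c \<Rightarrow> complex"
    and VC :: "'b set"
    and WC :: "(nat \<Rightarrow> complex) \<Rightarrow> 'c set"
    and vH :: "(nat \<Rightarrow> complex) \<Rightarrow> 'c"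
    and H1 H2 H3 :: "nat \<Rightarrow> complex"
    and Y :: "'c \<Rightarrow> complex \<Rightarrow> 'c \<Rightarrow> 'c"
  assumes n: "n > 0" "4 dvd n"
    and C: "binary_linear_code {1..n} C" "C \<subseteq> even_code {1..n}" "{1..n} \<in> C"
    and separating: "\<And>i j. \<lbrakk>i \<in> {1..n}; j \<in> {1..n}; i \<noteq> j\<rbrakk> \<Longrightarrow> \<exists>T\<in>C. i \<in> T \<and> j \<notin> T"
    and ising: "ising_modules V L v f"
    and tensor: "ising_tensor_modules n V L f VV \<tau>0 W \<tau> F"
    and vH: "vH = lowest_vector n v \<tau>"
    and VC: "VC = code_subring n V VV \<tau>0 C"
    and WC: "WC = (\<lambda>H. generated_submodule VC (W H) (vH H))"
    and H: "H1 \<in> {1..n} \<rightarrow>\<^sub>E ising_weights" "H2 \<in> {1..n} \<rightarrow>\<^sub>E ising_weights"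
           "H3 \<in> {1..n} \<rightarrow>\<^sub>E ising_weights"
    and integral_forms: "\<And>H. H \<in> {H1, H2, H3} \<Longrightarrow> module_integral_form VV VC (W H) (WC H)"
    and Y: "intertwining_operator VV (W H1) (W H2) (W H3) Y"
  shows "integral_intertwining (WC H1) (WC H2) (graded_int_dual (W H3) (F H3) (WC H3)) Y \<longleftrightarrow>
    (\<forall>b. Y (vH H1) b (vH H2) \<in> wt_space VV (W H3) (\<Sum>i\<in>{1..n}. H3 i) \<longrightarrow>
      (\<exists>k::int. Y (vH H1) b (vH H2) = of_int k *\<^sub>C vH H3))"
proof
  interpret W1: ising_tensor_module n V L v f VV \<tau>0 W \<tau> F H1
    by unfold_locales (fact ising tensor H)+
  interpret W2: ising_tensor_module n V L v f VV \<tau>0 W \<tau> F H2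
    by unfold_locales (fact ising tensor H)+
  interpret W3: ising_tensor_module n V L v f VV \<tau>0 W \<tau> F H3
    by unfold_locales (fact ising tensor H)+
  have Ym: "vertex_map VV (W H1) (W H2) (W H3) Y"
    using Y by (simp add: intertwining_operator_def)
  have gen: "vH H \<in> WC H" for H
    unfolding WC generated_submodule_def by (intro hull_inc) simp
  have vH_closed: "vH H1 \<in> mspace (W H1)" "vH H2 \<in> mspace (W H2)" "vH H3 \<in> mspace (W H3)"
    unfolding vH by (rule W1.vH_closed W2.vH_closed W3.vH_closed)+
  define S where "S b = Y (vH H1) b (vH H2)" for b
  have S_closed: "S b \<in> mspace (W H3)" for b
    unfolding S_def using vH_closed vertex_mapD(1)[OF Ym] by auto
  {

    \<comment> \<open>Necessity: reading off the lowest coefficient by pairing with the lowest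
      weight vector\<close>
    assume int: "integral_intertwining (WC H1) (WC H2) (graded_int_dual (W H3) (F H3) (WC H3)) Y"
    show "\<forall>b. Y (vH H1) b (vH H2) \<in> wt_space VV (W H3) (\<Sum>i\<in>{1..n}. H3 i) \<longrightarrow>
      (\<exists>k::int. Y (vH H1) b (vH H2) = of_int k *\<^sub>C vH H3)"
    proof (intro allI impI)
      fix b
      assume wt: "Y (vH H1) b (vH H2) \<in> wt_space VV (W H3) (\<Sum>i\<in>{1..n}. H3 i)"
      have "F H3 (Y (vH H1) b (vH H2)) (vH H3) \<in> \<int>"
        using int gen by (auto simp: integral_intertwining_def graded_int_dual_def)
      then obtain k where "F H3 (Y (vH H1) b (vH H2)) (vH H3) = of_int k" by (rule Ints_cases)
      then show "\<exists>k::int. Y (vH H1) b (vH H2) = of_int k *\<^sub>C vH H3"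
        using W3.lowest_weight_space[OF wt] by (auto simp: vH)
    qed
  next

    \<comment> \<open>Sufficiency: generators of the vertex subring and reduction of modes\<close>
    assume lowest: "\<forall>b. Y (vH H1) b (vH H2) \<in> wt_space VV (W H3) (\<Sum>i\<in>{1..n}. H3 i) \<longrightarrow>
      (\<exists>k::int. Y (vH H1) b (vH H2) = of_int k *\<^sub>C vH H3)"
    let ?u = "\<lambda>T. W3.signed_conformal (code_sign T)"
    have T: "T \<subseteq> {1..n}" if "T \<in> C" for T using that C(1) by (auto simp: binary_linear_code_def)
    have gens: "code_conformal n V \<tau>0 ` C = ?u ` C"
      using T by (intro image_cong refl W3.code_conformal_eq) auto
    have VC': "VC = vertex_subring VV hull (?u ` C)"
      by (simp add: VC code_subring_def gens)
    have u_VC: "?u T \<in> VC" if "T \<in> C" for T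
      unfolding VC' using that by (intro hull_inc) auto
    have VC_sub: "VC \<subseteq> mspace VV"
      unfolding VC' by (intro vertex_subring_hull_subset[OF W3.VV]) (auto intro: W3.signed_conformal_closed)
    have sub: "subring_module VC (W H) (WC H)" if "H \<in> {H1, H2, H3}" for H
      using integral_forms[OF that] by (simp add: module_integral_form_def)

    have comm: "W3.LS s m (S b) = Y (vH H1) b (W2.LS s m (vH H2))
        + Y (W1.LS s (- 1) (vH H1)) (b + of_int m + 1) (vH H2)
        + ((of_int m + 1) * (\<Sum>i\<in>{1..n}. of_int (s i) * H1 i)) *\<^sub>C S (b + of_int m)" for s m b
    proof -
      \<comment> \<open>\<open>signed_conformal\<close> is independent of the label
        \<open>H\<close>, so the same vector of \<open>VV\<close> acts on all three modules.\<close>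
      have one: "action (W H1) (W3.signed_conformal s) 1 (vH H1)
          = (\<Sum>i\<in>{1..n}. of_int (s i) * H1 i) *\<^sub>C vH H1"
        using W1.LS_vH(1)[of s] by (simp add: vH W1.LS_def)
      have high: "action (W H1) (W3.signed_conformal s) i (vH H1) = 0" if "i \<ge> 2" for i
        using W1.LS_vH(2)[of "i - 1" s] that by (simp add: vH W1.LS_def)
      show ?thesis
        using vertex_map_primary_commutator[OF Ym W1.W W3.signed_conformal_closed vH_closed(1,2) one high,
            of "m + 1" b]
        by (simp add: S_def W1.LS_def W2.LS_def W3.LS_def add.commute add.left_commute)
    qed
    note lin2 = vertex_mapD(2)[OF Ym vH_closed(1)]
    have zero: "W3.LS s 0 (S b) = (\<Sum>i\<in>{1..n}. of_int (s i) * H2 i) *\<^sub>C S b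
        + Y (W1.LS s (- 1) (vH H1)) (b + 1) (vH H2) + (\<Sum>i\<in>{1..n}. of_int (s i) * H1 i) *\<^sub>C S b" for s b
      using comm[of s 0 b] W2.LS_vH(1)[of s] linear_on_scale[OF lin2 vH_closed(2)]
      by (simp add: vH S_def)
    \<comment> \<open>Formula \<open>zero\<close> at index \<open>b + of_int m\<close> contains the
      same coefficient of \<open>L(-1)v1\<close> as \<open>comm\<close> at \<open>m\<close>.
      Subtracting removes it and leaves \<open>(m + 1) - 1 = m\<close> times the first weight minus
      the second.\<close>
    have reduce: "W3.LS s m (S b) = W3.LS s 0 (S (b + of_int m))
        + (of_int m * (\<Sum>i\<in>{1..n}. of_int (s i) * H1 i) - (\<Sum>i\<in>{1..n}. of_int (s i) * H2 i))
          *\<^sub>C S (b + of_int m)" if "m > 0" for s m b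
      using comm[of s m b] W2.LS_vH(2)[OF that, of s] linear_on_0[OF lin2 W2.subspace_W]
      by (simp add: vH zero cvs.scale_left_diff_distrib scaleC_add_left distrib_right)

    \<comment> \<open>Weights of the coefficients and integrality of their strings\<close>
    have S_weight: "S b \<in> wt_space VV (W H3) ((\<Sum>i\<in>{1..n}. H2 i) - (b + 1) + (\<Sum>i\<in>{1..n}. H1 i))" for b
    proof -
      \<comment> \<open>With all signs 1 the unknown coefficient is determined by the
        \<open>L(-1)\<close>-derivative property.\<close>
      have "Y (W1.LS (\<lambda>_. 1) (- 1) (vH H1)) (b + 1) (vH H2) = - ((b + 1) *\<^sub>C S b)"
        using Y vH_closed(1,2) unfolding intertwining_operator_def
        by (simp add: W1.LS_def virL_def W1.conformal_eq S_def)
      then show ?thesis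
        using zero[of "\<lambda>_. 1" b] S_closed
        by (simp add: W3.wt_space_iff scaleC_add_left cvs.scale_left_diff_distrib)
    qed

    have S_int: "F H3 (S b) (vH H3) \<in> \<int>" for b
    \<comment> \<open>Outside the lowest weight space, \<open>S b\<close> has a different weight and
      is orthogonal to the lowest weight vector.\<close>
    proof (cases "S b \<in> wt_space VV (W H3) (\<Sum>i\<in>{1..n}. H3 i)")
      case True
      then obtain k where "S b = of_int k *\<^sub>C vH H3" using lowest by (auto simp: S_def)
      then show ?thesis
        using linear_on_scale[OF W3.linear_F(2) vH_closed(3), of "vH H3"] vH_closed(3) W3.F_vH
        by (simp add: vH scaleC_complex_def)
    next
      case False
      then have "F H3 (S b) (vH H3) = 0"
        unfolding vH using S_weight[of b] W3.vH_weight by (intro W3.weight_orthogonal) (auto simp: vH)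
      then show ?thesis by simp
    qed

    have weight_Ints: "(\<Sum>i\<in>{1..n}. of_int (code_sign T i) * H i) \<in> \<int>"
      if "T \<in> C" "H \<in> {H1, H2, H3}" for T H
    proof -
      note form = integral_forms[OF that(2)] and u = u_VC[OF that(1)] and g = gen[unfolded vH]
      from that(2) show ?thesis
        using W1.code_weight_Ints[OF _ u g] W2.code_weight_Ints[OF _ u g] W3.code_weight_Ints[OF _ u g] form
        by auto
    qed
    let ?st = "foldr (\<lambda>(T, m). W3.LS (code_sign T) m)"
    have string: "F H3 (?st xs (S b)) (vH H3) \<in> \<int>" if xs: "fst ` set xs \<subseteq> C" for xs b
    proof (rule mode_string_integral[where X = "\<lambda>T. W3.LS (code_sign T)" and E = "mspace (W H3)"
          and \<phi> = "\<lambda>w. F H3 w (vH H3)" and mul = "\<lambda>R T. (R - T) \<union> (T - R)", OF _ _ _ _ _ _ _ _ _ _ _ xs])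
      show "\<And>R T m k w. R \<in> C \<Longrightarrow> T \<in> C \<Longrightarrow> w \<in> mspace (W H3) \<Longrightarrow>
        \<exists>d\<in>\<int>. W3.LS (code_sign R) m (W3.LS (code_sign T) k w) - W3.LS (code_sign T) k (W3.LS (code_sign R) m w)
          = of_int (m - k) *\<^sub>C W3.LS (code_sign (R - T \<union> (T - R))) (m + k) w + d *\<^sub>C w"
        by (rule W3.LS_code_commutator[OF n(2) C(1,2)])
      show "R - T \<union> (T - R) \<in> C" if "R \<in> C" "T \<in> C" for R T
        using C(1) that by (auto simp: binary_linear_code_def)
      show "\<exists>e\<in>\<int>. W3.LS (code_sign T) m (S b) = W3.LS (code_sign T) 0 (S (b + of_int m)) + e *\<^sub>C S (b + of_int m)"
        if "T \<in> C" "m > 0" for T m b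
        by (rule bexI, rule reduce[OF that(2)])
          (intro Ints_diff Ints_mult Ints_of_int weight_Ints that insertI1 insertI2)
      \<comment> \<open>The adjoint mode has positive index and kills the lowest weight
        vector.\<close>
      show "F H3 (W3.LS (code_sign T) m w) (vH H3) = 0" if "m < 0" "w \<in> mspace (W H3)" for T m w
        using that W3.F_adjoint[OF that(2) vH_closed(3)] W3.LS_vH(2)[of "- m"]
          linear_on_0[OF W3.linear_F(1)[OF that(2)] W3.subspace_W] by (simp add: vH)
      show "\<exists>h\<in>\<int>. \<forall>w\<in>mspace (W H3). F H3 (W3.LS (code_sign T) 0 w) (vH H3) = h * F H3 w (vH H3)"
        if "T \<in> C" for T
      proof (intro bexI ballI)
        fix w assume w: "w \<in> mspace (W H3)"
        show "F H3 (W3.LS (code_sign T) 0 w) (vH H3)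
            = (\<Sum>i\<in>{1..n}. of_int (code_sign T i) * H3 i) * F H3 w (vH H3)"
          using W3.F_adjoint[OF w vH_closed(3), of "code_sign T" 0] W3.LS_vH(1)[of "code_sign T"]
            linear_on_scale[OF W3.linear_F(1)[OF w] vH_closed(3)]
          by (simp add: vH scaleC_complex_def)
      qed (intro weight_Ints that insertI1 insertI2)
    qed (use S_int S_closed vH_closed W3.LS_closed W3.linear_LS W3.linear_F W3.subspace_W in auto)

    \<comment> \<open>From pairings with the lowest weight vector to the dual lattice\<close>
    let ?N = "{x \<in> mspace (W H3). \<forall>xs b. fst ` set xs \<subseteq> C \<longrightarrow> F H3 (?st xs (S b)) x \<in> \<int>}"
    have st_closed: "?st xs (S b) \<in> mspace (W H3)" for xs b
      by (induction xs) (auto intro: S_closed W3.LS_closed)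
    have act: "action (W H3) (?u T) m w = W3.LS (code_sign T) (m - 1) w" for T m w
      by (simp add: W3.LS_def)
    have "subring_module VC (W H3) ?N"
      unfolding VC'
    proof (rule subring_module_hull[OF W3.VV W3.W])
      show "add_subgroup ?N"
        using linear_on_0[OF W3.linear_F(1)[OF st_closed] W3.subspace_W]
          linear_on_diff[OF W3.linear_F(1)[OF st_closed] W3.subspace_W] W3.subspace_W
        by (auto simp: add_subgroup_def cvs.subspace_0 cvs.subspace_diff)
      show "action (W H3) u m w \<in> ?N" if u: "u \<in> ?u ` C" and w: "w \<in> ?N" for u m w
      proof -
        obtain T where T: "T \<in> C" "u = ?u T" using u by auto
        have wm: "w \<in> mspace (W H3)" using w by simp
        have "F H3 (?st xs (S b)) (action (W H3) u m w) \<in> \<int>" if xs: "fst ` set xs \<subseteq> C" for xs b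
        proof -
          \<comment> \<open>Mode \<open>m\<close> of the codeword vector is \<open>L(m - 1)\<close>;
            moved to the other side of the form it becomes \<open>L(1 - m)\<close> and prolongs the
            string.\<close>
          have "F H3 (?st ((T, 1 - m) # xs) (S b)) w \<in> \<int>"
            using w xs T(1) by (auto simp del: foldr.simps)
          then show ?thesis
            using W3.F_adjoint[OF st_closed wm, of "code_sign T" "1 - m" xs b] by (simp add: T(2) act)
        qed
        then show ?thesis using W3.LS_closed[OF wm] by (simp add: T(2) act)
      qed
    qed (auto intro: W3.signed_conformal_closed)
    then have "WC H3 \<subseteq> ?N"
      unfolding WC generated_submodule_def using vH_closed(3) string by (intro hull_minimal) auto
    \<comment> \<open>The empty string gives the pairings of \<open>S b\<close> itself.\<close>
    then have S_dual: "S b \<in> graded_int_dual (W H3) (F H3) (WC H3)" for b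
      using S_closed by (auto simp: graded_int_dual_def dest!: subsetD spec[where x = "[]"])

    have WC_m: "WC H3 \<subseteq> mspace (W H3)" using sub[of H3] by (auto simp: subring_module_def)
    have dual: "subring_module VC (W H3) (graded_int_dual (W H3) (F H3) (WC H3))"
      unfolding VC'
    proof (rule subring_module_hull[OF W3.VV W3.W])
      show "add_subgroup (graded_int_dual (W H3) (F H3) (WC H3))"
        using linear_on_0[OF W3.linear_F(2) W3.subspace_W] WC_m
          linear_on_diff[OF W3.linear_F(2) W3.subspace_W] W3.subspace_W
        by (auto simp: add_subgroup_def graded_int_dual_def cvs.subspace_0 cvs.subspace_diff subset_iff)
      show "action (W H3) u m w \<in> graded_int_dual (W H3) (F H3) (WC H3)"
        if u: "u \<in> ?u ` C" and w: "w \<in> graded_int_dual (W H3) (F H3) (WC H3)" for u m w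
      proof -
        obtain T where T: "T \<in> C" "u = ?u T" using u by auto
        have wm: "w \<in> mspace (W H3)" using w by (simp add: graded_int_dual_def)
        have "F H3 (action (W H3) u m w) x \<in> \<int>" if x: "x \<in> WC H3" for x
        proof -
          \<comment> \<open>Mode \<open>2 - m\<close> is \<open>L(1 - m)\<close>, the adjoint of
            mode \<open>m\<close>.\<close>
          have "action (W H3) (?u T) (2 - m) x \<in> WC H3"
            using sub[of H3] u_VC[OF T(1)] x by (auto simp: subring_module_def)
          then have "F H3 w (action (W H3) (?u T) (2 - m) x) \<in> \<int>"
            using w by (simp add: graded_int_dual_def)
          then show ?thesis
            using W3.F_adjoint[OF wm subsetD[OF WC_m x], of "code_sign T" "m - 1"] by (simp add: T(2) act)
        qed
        then show ?thesis using W3.LS_closed[OF wm] by (simp add: graded_int_dual_def T(2) act)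
      qed
    qed (auto simp: graded_int_dual_def intro: W3.signed_conformal_closed)
    show "integral_intertwining (WC H1) (WC H2) (graded_int_dual (W H3) (F H3) (WC H3)) Y"
      using S_dual sub[of H2] unfolding WC S_def
      by (intro integral_intertwining_generated[OF Ym W1.W W2.W W3.W VC_sub dual[unfolded WC] vH_closed(1,2)]) auto
  }
qed

end
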